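(* Let $X$ be a (non-Euclidean) analytic normed plane, let $z\in X$ be normal, and let $\mathcal{H}$ be an open half-plane formed by the line through $0$ and $z$. Then there exists a comeagre subset of points $y\in\mathcal{H}$ such that the following holds: for any $t\in\mathbb{T}$, if $r_z(R_z(\cdot),t)$ is not an isometry then there exists an open conull subset of $\mathcal{H}$ of points $x$ where $$\|r_z(R_z(x),t)-r_z(R_z(y),t)\|\neq\|x-y\|.$$
   Context: A normed plane is a $2$-dimensional real normed space. It is analytic if the restriction of its norm to $X\setminus\{0\}$ is a real analytic function (in linear coordinates), and non-Euclidean if its norm does not come from an inner product. Negligible sets: $S\subset O$, with $O$ open, is a conull (resp. comeagre) subset of $O$ if $O\setminus S$ has Lebesgue measure $0$ (resp. is a countable union of nowhere dense sets). Lebesgue measure is taken after identifying the space with $\mathbb{R}^d$. Reflections: for non-zero $z\in X$, $R_z:X\to X$ is the unique map with $R_z(x)=x$ for $x\in\operatorname{span}\{z\}$ and, for $x\notin\operatorname{span}\{z\}$, $R_z(x)$ the unique point distinct from $x$ with $\|R_z(x)\|=\|x\|$ and $\|R_z(x)-z\|=\|x-z\|$. Rotations: $\mathbb{T}=\mathbb{R}/2\pi\mathbb{Z}$ and $S_r[0]=\{x\in X:\|x\|=r\}$. For non-zero $z\in X$ fix an analytic bijection $f:\mathbb{T}\to S_{\|z\|}[0]$ with $f(0)=z$ and $\|f'(t)\|$ constant (there are exactly two such maps, $t\mapsto f(t)$ and $t\mapsto f(-t)$; either choice may be used). Then $r_z:X\times\mathbb{T}\to X$ denotes the unique continuous map with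 $r_z(z,t)=f(t)$, $r_z(x,0)=x$, $\|r_z(x,t)\|=\|x\|$ and $\|r_z(x,t)-r_z(z,t)\|=\|x-z\|$ for all $x\in X$, $t\in\mathbb{T}$. Normal points: for a finite simple graph $G=(V,E)$ and $p\in X^V$ (a placement; $(G,p)$ is a framework) let $f_G(p)=(\frac12\|p_v-p_w\|^2)_{vw\in E}\in\mathbb{R}^E$. The framework $(G,p)$ is well-positioned if $f_G$ is differentiable at $p$ and $p_v\neq p_w$ for all $vw\in E$. It is regular if it is well-positioned and $\operatorname{rank} df_G(p)$ is maximal among well-positioned placements of $G$. It is strongly regular if it is well-positioned and $(G,q)$ is regular for every $q$ with $f_G(q)=f_G(p)$. The placement $p$ (or the framework) is completely strongly regular if for every graph $H$ with vertex set $V$, $(H,p)$ is well-positioned and strongly regular. With $K_4$ the complete graph on $v_0,v_1,v_2,v_3$, a point $z\in X\setminus\{0\}$ is normal if there is a completely strongly regular framework $(K_4,p)$ in $X$ with $p_{v_0}=0$ and $p_{v_1}=z$. *)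

theory Defs
  imports "HOL-Analysis.Analysis"
begin

text \<open>Local expansion as a multivariate power series. A multi-index is a function
  \<open>m \<in> Basis \<rightarrow>\<^sub>E UNIV\<close>, with values \<open>m b :: nat\<close>. For functions on the real line
  the only basis element is 1 and this is an ordinary power series with vector coefficients.\<close>

definition real_analytic_on :: "('e::euclidean_space \<Rightarrow> 'b::real_normed_vector) \<Rightarrow> 'e set \<Rightarrow> bool"
    (infixl \<open>(real'_analytic'_on)\<close> 50) where
  "f real_analytic_on S \<longleftrightarrow>
    (\<forall>a\<in>S. \<exists>(c :: ('e \<Rightarrow> nat) \<Rightarrow> 'b) \<rho>. \<rho> > 0 \<and>
      (\<forall>h. norm h < \<rho> \<longrightarrow>
        ((\<lambda>m. (\<Prod>b\<in>Basis. (h \<bullet> b) ^ m b) *\<^sub>R c m) has_sum f (a + h)) (Basis \<rightarrow>\<^sub>E UNIV)))"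

definition normed_plane :: "'a::real_normed_vector itself \<Rightarrow> bool" where
  "normed_plane _ \<longleftrightarrow> dim (UNIV :: 'a set) = 2"

definition linear_coordinates :: "(real ^ 2 \<Rightarrow> 'a::real_normed_vector) \<Rightarrow> bool" where
  "linear_coordinates \<phi> \<longleftrightarrow> linear \<phi> \<and> bij \<phi>"

definition analytic_norm :: "'a::real_normed_vector itself \<Rightarrow> bool" where
  "analytic_norm _ \<longleftrightarrow>
    (\<exists>\<phi> :: real ^ 2 \<Rightarrow> 'a. linear_coordinates \<phi> \<and> (\<lambda>u. norm (\<phi> u)) real_analytic_on (- {0}))"

definition euclidean_norm :: "'a::real_normed_vector itself \<Rightarrow> bool" where
  "euclidean_norm _ \<longleftrightarrow>
    (\<exists>B :: 'a \<Rightarrow> 'a \<Rightarrow> real. bilinear B \<and> (\<forall>x y. B x y = B y x) \<and> (\<forall>x. norm x = sqrt (B x x))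
       \<and> (\<forall>x. x \<noteq> 0 \<longrightarrow> B x x > 0))"

definition open_half_plane :: "'a::real_normed_vector \<Rightarrow> 'a set \<Rightarrow> bool" where
  "open_half_plane z H \<longleftrightarrow>
    (\<exists>g :: 'a \<Rightarrow> real. linear g \<and> {x. g x = 0} = span {z} \<and> H = {x. g x > 0})"

definition isometry :: "('a::metric_space \<Rightarrow> 'b::metric_space) \<Rightarrow> bool" where
  "isometry f \<longleftrightarrow> (\<forall>x y. dist (f x) (f y) = dist x y)"

text \<open>Being null does not depend on the choice of the linear identification with \<open>real ^ 2\<close>.\<close>

definition lebesgue_null :: "'a::real_normed_vector set \<Rightarrow> bool" where
  "lebesgue_null S \<longleftrightarrow>
    (\<exists>\<phi> :: real ^ 2 \<Rightarrow> 'a. linear_coordinates \<phi> \<and> \<phi> -` S \<in> null_sets lebesgue)"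

definition conull_subset :: "'a::real_normed_vector set \<Rightarrow> 'a set \<Rightarrow> bool" where
  "conull_subset S W \<longleftrightarrow> S \<subseteq> W \<and> lebesgue_null (W - S)"

definition nowhere_dense :: "'a::topological_space set \<Rightarrow> bool" where
  "nowhere_dense A \<longleftrightarrow> interior (closure A) = {}"

definition comeagre_subset :: "'a::topological_space set \<Rightarrow> 'a set \<Rightarrow> bool" where
  "comeagre_subset S W \<longleftrightarrow>
    S \<subseteq> W \<and> (\<exists>\<A>. countable \<A> \<and> (\<forall>A\<in>\<A>. nowhere_dense A) \<and> W - S = \<Union>\<A>)"

definition plane_reflection :: "'a::real_normed_vector \<Rightarrow> 'a \<Rightarrow> 'a" where
  "plane_reflection z x =
    (if x \<in> span {z} then x
     else (THE y. y \<noteq> x \<and> norm y = norm x \<and> norm (y - z) = norm (x - z)))"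

text \<open>Functions on \<open>\<real>/2\<pi>\<int>\<close> are encoded as \<open>2\<pi>\<close>-periodic functions on the reals.
  A constant-speed analytic parametrisation of the circle through \<open>z\<close> starting at \<open>z\<close>;
  there are exactly two of these, one for each orientation; each determines one map
  \<open>r\<close> with \<open>rotation_map z f r\<close>.\<close>

definition circle_param :: "'a::real_normed_vector \<Rightarrow> (real \<Rightarrow> 'a) \<Rightarrow> bool" where
  "circle_param z f \<longleftrightarrow>
    (\<forall>t. f (t + 2 * pi) = f t) \<and>
    f real_analytic_on UNIV \<and>
    bij_betw f {0..<2 * pi} (sphere 0 (norm z)) \<and>
    f 0 = z \<and>
    (\<exists>c. \<forall>t. norm (vector_derivative f (at t)) = c)"

definition rotation_map :: "'a::real_normed_vector \<Rightarrow> (real \<Rightarrow> 'a) \<Rightarrow> ('a \<Rightarrow> real \<Rightarrow> 'a) \<Rightarrow> bool" where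
  "rotation_map z f r \<longleftrightarrow>
    (\<forall>x t. r x (t + 2 * pi) = r x t) \<and>
    continuous_on UNIV (\<lambda>(x, t). r x t) \<and>
    (\<forall>t. r z t = f t) \<and>
    (\<forall>x. r x 0 = x) \<and>
    (\<forall>x t. norm (r x t) = norm x) \<and>
    (\<forall>x t. norm (r x t - r z t) = norm (x - z))"

text \<open>The vertex set is a finite type \<open>'v\<close>, a simple graph on it is its set of edges.\<close>

definition simple_graph :: "'v::finite set set \<Rightarrow> bool" where
  "simple_graph E \<longleftrightarrow> (\<forall>e\<in>E. card e = 2)"

definition edge_length :: "'a::real_normed_vector ^ 'v \<Rightarrow> 'v set \<Rightarrow> real" where
  "edge_length p e = (THE l. \<exists>v w. e = {v, w} \<and> l = norm (p $ v - p $ w))"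

lemma edge_length_doubleton [simp]: "edge_length p {v, w} = norm (p $ v - p $ w)"
  unfolding edge_length_def
  by (rule the_equality) (auto simp: doubleton_eq_iff norm_minus_commute)

text \<open>The rigidity map. Its codomain is embedded in the functions on all vertex sets, with zero
  entries outside the edge set; this affects neither differentiability, nor rank, nor fibres.\<close>

definition rigidity_map :: "'v::finite set set \<Rightarrow> 'a::real_normed_vector ^ 'v \<Rightarrow> real ^ ('v set)" where
  "rigidity_map E p = (\<chi> e. if e \<in> E then (edge_length p e)\<^sup>2 / 2 else 0)"

definition rigidity_rank :: "'v::finite set set \<Rightarrow> 'a::real_normed_vector ^ 'v \<Rightarrow> nat" where
  "rigidity_rank E p = dim (range (frechet_derivative (rigidity_map E) (at p)))"

definition well_positioned :: "'v::finite set set \<Rightarrow> 'a::real_normed_vector ^ 'v \<Rightarrow> bool" where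
  "well_positioned E p \<longleftrightarrow>
    rigidity_map E differentiable (at p) \<and> (\<forall>v w. {v, w} \<in> E \<longrightarrow> p $ v \<noteq> p $ w)"

definition regular_framework :: "'v::finite set set \<Rightarrow> 'a::real_normed_vector ^ 'v \<Rightarrow> bool" where
  "regular_framework E p \<longleftrightarrow>
    well_positioned E p \<and> (\<forall>q :: 'a ^ 'v. well_positioned E q \<longrightarrow> rigidity_rank E q \<le> rigidity_rank E p)"

definition strongly_regular :: "'v::finite set set \<Rightarrow> 'a::real_normed_vector ^ 'v \<Rightarrow> bool" where
  "strongly_regular E p \<longleftrightarrow>
    well_positioned E p \<and> (\<forall>q :: 'a ^ 'v. rigidity_map E q = rigidity_map E p \<longrightarrow> regular_framework E q)"

definition completely_strongly_regular :: "'a::real_normed_vector ^ 'v::finite \<Rightarrow> bool" where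
  "completely_strongly_regular p \<longleftrightarrow>
    (\<forall>E. simple_graph E \<longrightarrow> well_positioned E p \<and> strongly_regular E p)"

text \<open>Vertices are the elements of the four-element type \<open>4\<close>. The edge set of the complete
  graph does not appear because complete strong regularity only depends on the placement.\<close>

definition normal_point :: "'a::real_normed_vector \<Rightarrow> bool" where
  "normal_point z \<longleftrightarrow>
    z \<noteq> 0 \<and> (\<exists>p :: 'a ^ 4. completely_strongly_regular p \<and> p $ 0 = 0 \<and> p $ 1 = z)"

end

theory Submission
  imports Defs "HOL-Complex_Analysis.Conformal_Mappings"
begin

text \<open>Write \<open>S\<close> for the reflection followed by the rotation with parameter \<open>t\<close>, and \<open>z' = f t\<close>. Both maps preserve
  the distance to the origin and turn the distance to \<open>z\<close> into the distance to the image of \<open>z\<close>. So the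
  triangle \<open>0, z', S x\<close> has the side lengths of \<open>0, z, x\<close>, with the apex on the opposite side of its base. A point
  off the base is determined by its side and the two remaining side lengths \<open>(a, b)\<close>; in these coordinates \<open>S\<close> is the
  identity. The theorem holds with \<open>Y = H\<close>: for every \<open>y\<close> in \<open>H\<close>, the set of \<open>x\<close> with
  \<open>norm (S x - S y) = norm (x - y)\<close> is null unless \<open>S\<close> is an isometry.

  There are two steps. The first is a dichotomy (\<open>equidistance_null_or_everywhere\<close>): this set is null or all of \<open>H\<close>.
  With \<open>a\<close> fixed, the apex moves on an arc of a circle and is an analytic function of \<open>b\<close>, and likewise with the roles
  exchanged. Hence the difference of the two distances is separately analytic in \<open>a\<close> and \<open>b\<close> away from the side
  lengths of \<open>y\<close>. If its zero set is not null, then by Tonelli's theorem it contains uncountably many points on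
  each of uncountably many lines, and the one-dimensional identity theorem, used on both families of lines in turn
  (\<open>separately_analytic_zero\<close>), makes the difference vanish everywhere.

  The second step excludes the case that the set is all of \<open>H\<close> (\<open>equidistant_imp_linear_isometry\<close>,
  \<open>rotated_reflection_isometry\<close>). In that case the derivative \<open>L\<close> of \<open>S\<close> at \<open>y\<close> is a linear isometry. An analytic norm
  is smooth and strictly convex (\<open>nd_extremal\<close>), so a point is determined by its norm and its supporting
  functional. As \<open>S\<close> preserves the distance to \<open>0\<close> and carries the distance to \<open>z\<close> to the distance to \<open>z'\<close>,
  comparing supporting functionals at \<open>y\<close> and \<open>S y\<close> gives \<open>L y = S y\<close> and \<open>L z = z'\<close>. Then \<open>L x\<close> and \<open>S x\<close> have the same
  distances to \<open>0\<close> and \<open>z'\<close> and lie on the same side of the base, so \<open>S = L\<close> is an isometry.\<close>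

section \<open>Functions of one real variable with a holomorphic extension\<close>

text \<open>Analyticity at a point is expressed by a local holomorphic extension. Closure under arithmetic,
  composition and inversion, and the identity theorem, are then inherited from complex analysis.\<close>

definition real_analytic_at :: "(real \<Rightarrow> real) \<Rightarrow> real \<Rightarrow> bool" where
  "real_analytic_at g s \<longleftrightarrow>
    (\<exists>G. G analytic_on {complex_of_real s} \<and>
      (\<forall>\<^sub>F t in nhds s. G (complex_of_real t) = complex_of_real (g t)))"

lemma real_analytic_atI:
  assumes "G analytic_on {complex_of_real s}"
    and "\<forall>\<^sub>F t in nhds s. G (complex_of_real t) = complex_of_real (g t)"
  shows "real_analytic_at g s"
  using assms unfolding real_analytic_at_def by blast

lemma real_analytic_atE:
  assumes "real_analytic_at g s"
  obtains G where "G analytic_on {complex_of_real s}"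
    and "\<forall>\<^sub>F t in nhds s. G (complex_of_real t) = complex_of_real (g t)"
    and "G (complex_of_real s) = complex_of_real (g s)"
proof -
  obtain G where "G analytic_on {complex_of_real s}"
    and ev: "\<forall>\<^sub>F t in nhds s. G (complex_of_real t) = complex_of_real (g t)"
    using assms unfolding real_analytic_at_def by (elim exE conjE)
  then show ?thesis using that eventually_nhds_x_imp_x[OF ev] by simp
qed

lemma real_analytic_at_const [simp]: "real_analytic_at (\<lambda>t. c) s"
  by (rule real_analytic_atI[where G = "\<lambda>_. of_real c"]) auto

lemma real_analytic_at_ident [simp]: "real_analytic_at (\<lambda>t. t) s"
  by (rule real_analytic_atI[where G = "\<lambda>z. z"]) auto

lemma real_analytic_at_cong:
  assumes "real_analytic_at g s" and "\<forall>\<^sub>F t in nhds s. h t = g t"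
  shows "real_analytic_at h s"
proof -
  obtain G where G: "G analytic_on {complex_of_real s}"
    "\<forall>\<^sub>F t in nhds s. G (complex_of_real t) = complex_of_real (g t)"
    using assms(1) by (rule real_analytic_atE)
  have "\<forall>\<^sub>F t in nhds s. G (complex_of_real t) = complex_of_real (h t)"
    using G(2) assms(2) by eventually_elim simp
  with G(1) show ?thesis by (rule real_analytic_atI)
qed

lemma real_analytic_at_add:
  assumes "real_analytic_at g s" and "real_analytic_at h s"
  shows "real_analytic_at (\<lambda>t. g t + h t) s"
proof -
  obtain G where G: "G analytic_on {complex_of_real s}"
    "\<forall>\<^sub>F t in nhds s. G (complex_of_real t) = complex_of_real (g t)"
    using assms(1) by (rule real_analytic_atE)
  obtain K where K: "K analytic_on {complex_of_real s}"
    "\<forall>\<^sub>F t in nhds s. K (complex_of_real t) = complex_of_real (h t)"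
    using assms(2) by (rule real_analytic_atE)
  have "\<forall>\<^sub>F t in nhds s. G (of_real t) + K (of_real t) = complex_of_real (g t + h t)"
    using G(2) K(2) by eventually_elim simp
  with G(1) K(1) show ?thesis
    by (intro real_analytic_atI[where G = "\<lambda>z. G z + K z"] analytic_intros)
qed

lemma real_analytic_at_mult:
  assumes "real_analytic_at g s" and "real_analytic_at h s"
  shows "real_analytic_at (\<lambda>t. g t * h t) s"
proof -
  obtain G where G: "G analytic_on {complex_of_real s}"
    "\<forall>\<^sub>F t in nhds s. G (complex_of_real t) = complex_of_real (g t)"
    using assms(1) by (rule real_analytic_atE)
  obtain K where K: "K analytic_on {complex_of_real s}"
    "\<forall>\<^sub>F t in nhds s. K (complex_of_real t) = complex_of_real (h t)"
    using assms(2) by (rule real_analytic_atE)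
  have "\<forall>\<^sub>F t in nhds s. G (of_real t) * K (of_real t) = complex_of_real (g t * h t)"
    using G(2) K(2) by eventually_elim simp
  with G(1) K(1) show ?thesis
    by (intro real_analytic_atI[where G = "\<lambda>z. G z * K z"] analytic_intros)
qed

lemma real_analytic_at_minus:
  assumes "real_analytic_at g s"
  shows "real_analytic_at (\<lambda>t. - g t) s"
  using real_analytic_at_mult[OF real_analytic_at_const[of "-1"] assms] by simp

lemma real_analytic_at_diff:
  assumes "real_analytic_at g s" and "real_analytic_at h s"
  shows "real_analytic_at (\<lambda>t. g t - h t) s"
  using real_analytic_at_add[OF assms(1) real_analytic_at_minus[OF assms(2)]] by simp

lemma real_analytic_at_divide:
  assumes "real_analytic_at g s" and "real_analytic_at h s" and "h s \<noteq> 0"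
  shows "real_analytic_at (\<lambda>t. g t / h t) s"
proof -
  obtain G where G: "G analytic_on {complex_of_real s}"
    "\<forall>\<^sub>F t in nhds s. G (complex_of_real t) = complex_of_real (g t)"
    using assms(1) by (rule real_analytic_atE)
  obtain K where K: "K analytic_on {complex_of_real s}"
    "\<forall>\<^sub>F t in nhds s. K (complex_of_real t) = complex_of_real (h t)"
    "K (complex_of_real s) = complex_of_real (h s)"
    using assms(2) by (rule real_analytic_atE)
  have "\<forall>\<^sub>F t in nhds s. G (of_real t) / K (of_real t) = complex_of_real (g t / h t)"
    using G(2) K(2) by eventually_elim simp
  moreover have "(\<lambda>z. G z / K z) analytic_on {complex_of_real s}"
    using G(1) K(1) by (rule analytic_on_divide) (use K(3) assms(3) in auto)
  ultimately show ?thesis by (intro real_analytic_atI)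
qed

lemma real_analytic_at_imp_isCont:
  assumes "real_analytic_at g s" shows "isCont g s"
proof -
  obtain G where G: "G analytic_on {complex_of_real s}"
    "\<forall>\<^sub>F t in nhds s. G (complex_of_real t) = complex_of_real (g t)"
    using assms(1) by (rule real_analytic_atE)
  have "isCont (\<lambda>t. Re (G (complex_of_real t))) s"
    using isCont_o2[OF isCont_of_real[OF continuous_ident] analytic_at_imp_isCont[OF G(1)]]
    unfolding isCont_def by (rule tendsto_Re)
  moreover have "\<forall>\<^sub>F t in nhds s. Re (G (complex_of_real t)) = g t"
    using G(2) by eventually_elim simp
  ultimately show ?thesis by (rule isCont_cong[THEN iffD1, rotated])
qed

lemma real_analytic_at_compose:
  assumes "real_analytic_at g s" and "real_analytic_at h (g s)"
  shows "real_analytic_at (\<lambda>t. h (g t)) s"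
proof -
  obtain G where G: "G analytic_on {complex_of_real s}"
    "\<forall>\<^sub>F t in nhds s. G (complex_of_real t) = complex_of_real (g t)"
    "G (complex_of_real s) = complex_of_real (g s)"
    using assms(1) by (rule real_analytic_atE)
  obtain K where K: "K analytic_on {complex_of_real (g s)}"
    "\<forall>\<^sub>F t in nhds (g s). K (complex_of_real t) = complex_of_real (h t)"
    using assms(2) by (rule real_analytic_atE)
  have "\<forall>\<^sub>F t in nhds s. K (complex_of_real (g t)) = complex_of_real (h (g t))"
    using real_analytic_at_imp_isCont[OF assms(1)] K(2)
    unfolding isCont_def tendsto_at_iff_tendsto_nhds by (rule eventually_compose_filterlim[rotated])
  then have "\<forall>\<^sub>F t in nhds s. (K \<circ> G) (complex_of_real t) = complex_of_real (h (g t))"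
    using G(2) by eventually_elim simp
  moreover have "(K \<circ> G) analytic_on {complex_of_real s}"
    using G K(1) by (intro analytic_on_compose) auto
  ultimately show ?thesis by (intro real_analytic_atI)
qed

text \<open>The derivative of the holomorphic extension at the point agrees with the real one, so it is non-zero and
  the extension is invertible nearby; its inverse extends the real inverse.\<close>

lemma real_analytic_at_inverse:
  assumes h: "real_analytic_at h s" and der: "(h has_real_derivative d) (at s)" "d \<noteq> 0"
    and inv: "\<And>t. \<bar>t - s\<bar> < e \<Longrightarrow> k (h t) = t" "0 < e"
    and cont: "\<And>t. \<bar>t - s\<bar> < e \<Longrightarrow> isCont h t"
    and right: "\<forall>\<^sub>F b in nhds (h s). h (k b) = b"
  shows "real_analytic_at k (h s)"
proof -
  obtain G where G: "G analytic_on {complex_of_real s}"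
    "\<forall>\<^sub>F t in nhds s. G (complex_of_real t) = complex_of_real (h t)"
    "G (complex_of_real s) = complex_of_real (h s)"
    using h by (rule real_analytic_atE)
  have kc: "isCont k (h s)"
    by (rule isCont_inverse_function[of "e/2"]) (use inv cont in auto)
  have ks: "k (h s) = s" using inv by simp
  obtain \<delta> where \<delta>: "\<delta> > 0" "G holomorphic_on ball (complex_of_real s) \<delta>"
    using G(1) analytic_at_ball by blast
  have dG: "(G has_field_derivative deriv G (of_real s)) (at (of_real s))"
    using analytic_on_imp_differentiable_at[OF G(1)] by (simp add: DERIV_deriv_iff_field_differentiable)
  \<comment> \<open>Otherwise \<open>h\<close>, the restriction of \<open>G\<close> to the real axis, would have derivative \<open>0\<close>.\<close>
  have dnz: "deriv G (of_real s) \<noteq> 0"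
  proof
    assume 0: "deriv G (of_real s) = 0"
    have "((\<lambda>t. G (complex_of_real t)) has_vector_derivative 1 * deriv G (of_real s)) (at s)"
      using field_vector_diff_chain_at[of of_real 1 s G "deriv G (of_real s)"] dG
        has_vector_derivative_of_real[OF DERIV_ident, where F = "at s"] by (simp add: o_def)
    with 0 have "((\<lambda>t. G (complex_of_real t)) has_derivative (\<lambda>x. 0)) (at s)"
      by (simp add: has_vector_derivative_def)
    then have "((\<lambda>t. complex_of_real (h t)) has_derivative (\<lambda>x. 0)) (at s)"
      by (rule has_derivative_transform_eventually)
        (use G(2,3) in \<open>auto simp: eventually_nhds_conv_at\<close>)
    then have "((\<lambda>t. complex_of_real (h t)) has_vector_derivative 0) (at s)"
      by (simp add: has_vector_derivative_def)
    then have "(h has_real_derivative 0) (at s)"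
      unfolding has_vector_derivative_complex_iff by simp
    from DERIV_unique[OF this der(1)] der(2) show False by simp
  qed
  obtain \<rho> where \<rho>: "\<rho> > 0" "ball (complex_of_real s) \<rho> \<subseteq> ball (complex_of_real s) \<delta>"
    "open (G ` ball (complex_of_real s) \<rho>)" "inj_on G (ball (complex_of_real s) \<rho>)"
    by (rule has_complex_derivative_locally_invertible[OF \<delta>(2) _ open_ball dnz]) (simp_all add: \<delta>(1))
  obtain K where K: "K holomorphic_on G ` ball (complex_of_real s) \<rho>"
    "\<And>z. z \<in> ball (complex_of_real s) \<rho> \<Longrightarrow> K (G z) = z"
    using holomorphic_has_inverse[OF holomorphic_on_subset[OF \<delta>(2) \<rho>(2)] open_ball \<rho>(4)] by metis
  have "of_real (h s) \<in> G ` ball (complex_of_real s) \<rho>"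
    unfolding G(3)[symmetric] using \<rho>(1) by (intro imageI) simp
  then have "K analytic_on {complex_of_real (h s)}"
    using K(1) \<rho>(3) analytic_at by blast
  moreover have "\<forall>\<^sub>F b in nhds (h s). K (of_real b) = of_real (k b)"
  proof -
    have "filterlim k (nhds s) (nhds (h s))"
      using kc[unfolded isCont_def tendsto_at_iff_tendsto_nhds] ks by simp
    moreover have "\<forall>\<^sub>F t in nhds s. dist t s < \<rho>"
      using \<rho>(1) by (auto simp: eventually_nhds_metric)
    ultimately have "\<forall>\<^sub>F b in nhds (h s). dist (k b) s < \<rho> \<and>
        G (complex_of_real (k b)) = complex_of_real (h (k b))"
      using G(2) by (intro eventually_conj) (auto elim: eventually_compose_filterlim)
    with right show ?thesis
    proof eventually_elim
      case (elim b)
      then have "complex_of_real (k b) \<in> ball (complex_of_real s) \<rho>"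
        by (simp add: dist_commute)
      from K(2)[OF this] elim show ?case by simp
    qed
  qed
  ultimately show ?thesis by (rule real_analytic_atI)
qed

lemma real_analytic_at_islimpt_zeros:
  assumes "real_analytic_at g s" and "s islimpt {t. g t = 0}"
  shows "\<forall>\<^sub>F t in nhds s. g t = 0"
proof -
  obtain G where G: "G analytic_on {complex_of_real s}"
    "\<forall>\<^sub>F t in nhds s. G (complex_of_real t) = complex_of_real (g t)"
    using assms(1) by (rule real_analytic_atE)
  obtain d where d: "d > 0" "G holomorphic_on ball (complex_of_real s) d"
    using G(1) analytic_at_ball by blast
  obtain e where e: "e > 0" "\<And>t. dist t s < e \<Longrightarrow> G (of_real t) = of_real (g t)"
    using G(2) by (auto simp: eventually_nhds_metric)
  define U where "U = {t. g t = 0 \<and> dist t s < min d e}"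
  have 1: "complex_of_real s islimpt (of_real ` U)"
    unfolding islimpt_approachable
  proof (intro allI impI)
    fix \<epsilon> :: real assume "\<epsilon> > 0"
    then have "0 < min \<epsilon> (min d e)" using d(1) e(1) by simp
    then obtain t where "g t = 0" "t \<noteq> s" "dist t s < min \<epsilon> (min d e)"
      using assms(2) unfolding islimpt_approachable by blast
    then show "\<exists>x'\<in>complex_of_real ` U. x' \<noteq> of_real s \<and> dist x' (of_real s) < \<epsilon>"
      unfolding U_def by (intro bexI[of _ "of_real t"]) auto
  qed
  have "G w = 0" if "w \<in> ball (complex_of_real s) d" for w
    by (rule analytic_continuation[OF d(2) _ _ _ _ 1]) (use d that e in \<open>auto simp: U_def dist_commute\<close>)
  then have "g t = 0" if "dist t s < min d e" for t
    using e(2)[of t] that by (auto simp: dist_commute)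
  then show ?thesis unfolding eventually_nhds_metric
    using d(1) e(1) by (intro exI[of _ "min d e"]) auto
qed

text \<open>The limit points of the zero set are closed in \<open>I\<close>, and open there because the function vanishes
  near each of them.\<close>

lemma real_analytic_zero_on_interval:
  fixes I :: "real set"
  assumes I: "open I" "connected I" and g: "\<And>t. t \<in> I \<Longrightarrow> real_analytic_at g t"
    and s: "s \<in> I" "s islimpt {t. g t = 0}" and t: "t \<in> I"
  shows "g t = 0"
proof -
  define L where "L = {t \<in> I. t islimpt {t. g t = 0}}"
  have near: "\<forall>\<^sub>F u in nhds t. g u = 0" if "t \<in> L" for t
    using that by (intro real_analytic_at_islimpt_zeros g) (simp_all add: L_def)
  have "\<exists>T. open T \<and> t \<in> T \<and> T \<subseteq> L" if t: "t \<in> L" for t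
  proof -
    obtain S where S: "open S" "t \<in> S" "\<forall>u\<in>S. g u = 0"
      using near[OF t] by (auto simp: eventually_nhds)
    have "S \<inter> I \<subseteq> L"
    proof
      fix u assume u: "u \<in> S \<inter> I"
      have "u islimpt S" using u S(1) by (intro interior_limit_point) (simp add: interior_open)
      then have "u islimpt {t. g t = 0}" by (rule islimpt_subset) (use S(3) in auto)
      with u show "u \<in> L" by (simp add: L_def)
    qed
    then show ?thesis
      using S I(1) t by (intro exI[of _ "S \<inter> I"]) (auto simp: L_def)
  qed
  then have "open L" by (subst open_subopen) auto
  then have "openin (top_of_set I) L" by (intro open_openin_trans[OF _ _ ]) (auto simp: L_def I)
  moreover have "closedin (top_of_set I) L"
  proof -
    have "L = I \<inter> {t. t islimpt {t. g t = 0}}" by (auto simp: L_def)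
    then show ?thesis using closed_limpts by (metis closedin_closed_Int)
  qed
  ultimately have "L = I" using I(2) s unfolding connected_clopen L_def by blast
  with t have "t \<in> L" by blast
  from eventually_nhds_x_imp_x[OF near[OF this]] show ?thesis .
qed

lemma uncountable_imp_islimpt:
  fixes A I :: "real set"
  assumes "open I" and "A \<subseteq> I" and "uncountable A"
  obtains s where "s \<in> I" and "s islimpt A"
proof -
  have "countable (I \<inter> A)" if "\<And>s. s \<in> I \<Longrightarrow> \<not> s islimpt A"
    by (rule sparse_imp_countable) (use assms(1) that in \<open>auto simp: sparse_in_open\<close>)
  moreover have "I \<inter> A = A" using assms(2) by blast
  ultimately show ?thesis using assms(3) that by metis
qed

text \<open>An uncountable set is the convenient source of a limit point inside an open interval: unlike
  infinite sets, it cannot accumulate at the boundary only.\<close>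

lemma real_analytic_uncountable_zeros:
  fixes I :: "real set"
  assumes "open I" "connected I" "\<And>t. t \<in> I \<Longrightarrow> real_analytic_at g t"
    and "uncountable {t \<in> I. g t = 0}" and "t \<in> I"
  shows "g t = 0"
proof -
  obtain s where s: "s \<in> I" "s islimpt {t \<in> I. g t = 0}"
    by (rule uncountable_imp_islimpt[OF assms(1) _ assms(4)]) auto
  from s(2) have "s islimpt {t. g t = 0}" by (rule islimpt_subset) auto
  from real_analytic_zero_on_interval[OF assms(1-3) s(1) this assms(5)] show ?thesis .
qed

section \<open>Real analytic functions of several variables\<close>

abbreviation multi_indices :: "('e::euclidean_space \<Rightarrow> nat) set" where
  "multi_indices \<equiv> Basis \<rightarrow>\<^sub>E UNIV"

text \<open>Absolute convergence at a corner of a cube inside the ball of convergence, as a majorant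
  that is uniform over the cube and over complex arguments of the same size.\<close>

lemma real_analytic_on_abs_summable:
  fixes g :: "'e::euclidean_space \<Rightarrow> real"
  assumes \<rho>: "\<rho> > 0" and r: "r = \<rho> / (2 * DIM('e))"
    and series: "\<And>h. norm h < \<rho> \<Longrightarrow>
      ((\<lambda>m. (\<Prod>b\<in>Basis. (h \<bullet> b) ^ m b) *\<^sub>R c m) has_sum g (a + h)) multi_indices"
  shows "(\<lambda>m. (\<Prod>b\<in>Basis. r ^ m b) * \<bar>c m\<bar>) summable_on multi_indices"
proof -
  have r0: "r > 0" using \<rho> by (simp add: r)
  \<comment> \<open>The corner of the cube of half-width \<open>r\<close>, at distance at most \<open>\<rho> / 2\<close> from its centre.\<close>
  define h :: 'e where "h = (\<Sum>b\<in>Basis. r *\<^sub>R b)"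
  have "norm h \<le> (\<Sum>b\<in>Basis. norm (r *\<^sub>R b :: 'e))" unfolding h_def by (rule norm_sum)
  also have "\<dots> = \<rho> / 2" using r0 \<rho> by (simp add: r)
  finally have "norm h < \<rho>" using \<rho> by simp
  then have "(\<lambda>m. (\<Prod>b\<in>Basis. (h \<bullet> b) ^ m b) *\<^sub>R c m) summable_on multi_indices"
    using series has_sum_imp_summable by blast
  then have "(\<lambda>m. norm ((\<Prod>b\<in>Basis. (h \<bullet> b) ^ m b) *\<^sub>R c m)) summable_on multi_indices"
    by (rule summable_on_iff_abs_summable_on_real[THEN iffD1])
  moreover have "norm ((\<Prod>b\<in>Basis. (h \<bullet> b) ^ m b) *\<^sub>R c m) = (\<Prod>b\<in>Basis. r ^ m b) * \<bar>c m\<bar>" for m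
  proof -
    have "h \<bullet> b = r" if "b \<in> Basis" for b
      using that by (simp add: h_def inner_sum_left inner_Basis if_distrib sum.delta cong: if_cong)
    then have "(\<Prod>b\<in>Basis. (h \<bullet> b) ^ m b) = (\<Prod>b\<in>Basis. r ^ m b)" by (intro prod.cong) auto
    moreover have "(\<Prod>b\<in>(Basis::'e set). r ^ m b) \<ge> 0" using r0 by (intro prod_nonneg) auto
    ultimately show ?thesis by (simp add: abs_mult)
  qed
  ultimately show ?thesis by simp
qed

text \<open>Substituting the holomorphic extensions of the components of \<open>P\<close> into the power series of \<open>g\<close> gives
  a series of holomorphic functions, which converges uniformly by the majorant above.\<close>

lemma real_analytic_on_compose_curve:
  fixes g :: "'e::euclidean_space \<Rightarrow> real" and P :: "real \<Rightarrow> 'e"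
  assumes g: "g real_analytic_on S" and PS: "P s \<in> S"
    and P: "\<And>b. b \<in> Basis \<Longrightarrow> real_analytic_at (\<lambda>t. P t \<bullet> b) s"
  shows "real_analytic_at (\<lambda>t. g (P t)) s"
proof -
  define a where "a = P s"
  obtain c \<rho> where \<rho>: "\<rho> > 0"
    and series: "\<And>h. norm h < \<rho> \<Longrightarrow>
      ((\<lambda>m. (\<Prod>b\<in>Basis. (h \<bullet> b) ^ m b) *\<^sub>R c m) has_sum g (a + h)) multi_indices"
    using g PS unfolding real_analytic_on_def a_def by blast
  define r where "r = \<rho> / (2 * DIM('e))"
  have r0: "r > 0" using \<rho> by (simp add: r_def)
  have summ: "(\<lambda>m. (\<Prod>b\<in>Basis. r ^ m b) * \<bar>c m\<bar>) summable_on multi_indices"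
    using \<rho> r_def series by (rule real_analytic_on_abs_summable)
  have "\<forall>b\<in>Basis. \<exists>Q. Q analytic_on {complex_of_real s} \<and>
      (\<forall>\<^sub>F t in nhds s. Q (of_real t) = complex_of_real (P t \<bullet> b))"
    using P unfolding real_analytic_at_def by blast
  then obtain Q where Q: "\<And>b. b \<in> Basis \<Longrightarrow> Q b analytic_on {complex_of_real s}"
    and QP: "\<And>b. b \<in> Basis \<Longrightarrow> \<forall>\<^sub>F t in nhds s. Q b (of_real t) = complex_of_real (P t \<bullet> b)"
    by metis
  define K where "K b z = Q b z - of_real (a \<bullet> b)" for b z
  have K0: "K b (of_real s) = 0" if "b \<in> Basis" for b
    using eventually_nhds_x_imp_x[OF QP[OF that]] by (simp add: K_def a_def)
  have Kan: "K b analytic_on {complex_of_real s}" if "b \<in> Basis" for b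
    unfolding K_def using Q[OF that] by (intro analytic_intros)
  have "\<forall>\<^sub>F z in nhds (complex_of_real s). norm (K b z) < r" if "b \<in> Basis" for b
  proof -
    have "isCont (K b) (of_real s)" using Kan[OF that] by (rule analytic_at_imp_isCont)
    then have "filterlim (K b) (nhds 0) (nhds (of_real s))"
      using K0[OF that] unfolding isCont_def tendsto_at_iff_tendsto_nhds by simp
    moreover have "\<forall>\<^sub>F w in nhds 0. norm (w::complex) < r"
      using r0 by (auto simp: eventually_nhds_metric)
    ultimately show ?thesis by (rule eventually_compose_filterlim[rotated])
  qed
  then have "\<forall>\<^sub>F z in nhds (complex_of_real s). \<forall>b\<in>Basis. norm (K b z) < r"
    by (intro eventually_ball_finite) auto
  then obtain e1 where e1: "e1 > 0" "\<And>z b. dist z (complex_of_real s) < e1 \<Longrightarrow> b \<in> Basis \<Longrightarrow> norm (K b z) < r"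
    unfolding eventually_nhds_metric by metis
  have "\<forall>b\<in>Basis. \<exists>d>0. K b holomorphic_on ball (complex_of_real s) d"
    using Kan analytic_at_ball by blast
  then obtain d where d: "\<And>b. b \<in> Basis \<Longrightarrow> d b > 0"
      "\<And>b. b \<in> Basis \<Longrightarrow> K b holomorphic_on ball (complex_of_real s) (d b)"
    by metis
  define e2 where "e2 = Min (d ` Basis)"
  have e2: "e2 > 0" "\<And>b. b \<in> Basis \<Longrightarrow> e2 \<le> d b"
    unfolding e2_def using d(1) by auto
  \<comment> \<open>Halving makes the closed disc fit into both open discs.\<close>
  define e where "e = min e1 e2 / 2"
  have e: "e > 0" "e < e1" "e < e2" using e1(1) e2(1) by (auto simp: e_def)
  define G where "G z = (\<Sum>\<^sub>\<infinity>m\<in>multi_indices. (\<Prod>b\<in>Basis. K b z ^ m b) * of_real (c m))" for z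
  have bound: "norm ((\<Prod>b\<in>Basis. K b z ^ m b) * of_real (c m)) \<le> (\<Prod>b\<in>Basis. r ^ m b) * \<bar>c m\<bar>"
    if "z \<in> cball (of_real s) e" for m z
  proof -
    have "norm (K b z) \<le> r" if "b \<in> Basis" for b
      using e1(2)[OF _ that, of z] \<open>z \<in> _\<close> e by (auto simp: dist_commute)
    then have "norm (\<Prod>b\<in>Basis. K b z ^ m b) \<le> (\<Prod>b\<in>Basis. r ^ m b)"
      unfolding prod_norm[symmetric] norm_power by (intro prod_mono conjI power_mono) auto
    then show ?thesis by (simp add: norm_mult mult_right_mono)
  qed
  have ulim: "uniform_limit (cball (of_real s) e)
      (\<lambda>X z. \<Sum>m\<in>X. (\<Prod>b\<in>Basis. K b z ^ m b) * of_real (c m)) G (finite_subsets_at_top multi_indices)"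
    unfolding G_def by (rule Weierstrass_m_test_general[OF bound summ])
  have hol: "(\<lambda>z. \<Sum>m\<in>X. (\<Prod>b\<in>Basis. K b z ^ m b) * of_real (c m)) holomorphic_on ball (of_real s) e2" for X
    using d(2) e2(2) by (intro holomorphic_intros) (meson holomorphic_on_subset subset_ball)
  obtain "G holomorphic_on ball (of_real s) e"
  proof (rule holomorphic_uniform_limit[OF _ ulim])
    have "cball (complex_of_real s) e \<subseteq> ball (of_real s) e2" using e by auto
    then show "\<forall>\<^sub>F X in finite_subsets_at_top multi_indices.
        continuous_on (cball (of_real s) e) (\<lambda>z. \<Sum>m\<in>X. (\<Prod>b\<in>Basis. K b z ^ m b) * of_real (c m)) \<and>
        (\<lambda>z. \<Sum>m\<in>X. (\<Prod>b\<in>Basis. K b z ^ m b) * of_real (c m)) holomorphic_on ball (of_real s) e"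
      by (intro always_eventually allI conjI holomorphic_on_imp_continuous_on holomorphic_on_subset[OF hol])
        (use e in auto)
  qed auto
  then have "G analytic_on {complex_of_real s}" using e(1) analytic_at_ball by blast
  moreover have "\<forall>\<^sub>F t in nhds s. G (of_real t) = of_real (g (P t))"
  proof -
    have "\<forall>\<^sub>F t in nhds s. \<forall>b\<in>Basis. Q b (of_real t) = complex_of_real (P t \<bullet> b)"
      using QP by (intro eventually_ball_finite) auto
    moreover have "\<forall>\<^sub>F t in nhds s. dist t s < e1"
      using e1(1) by (auto simp: eventually_nhds_metric)
    ultimately show ?thesis
    proof eventually_elim
      case (elim t)
      define h where "h = P t - a"
      have Kh: "K b (of_real t) = of_real (h \<bullet> b)" if "b \<in> Basis" for b
        using elim that by (simp add: K_def h_def inner_diff_left)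
      have "\<bar>h \<bullet> b\<bar> \<le> r" if "b \<in> Basis" for b
        using e1(2)[OF _ that, of "of_real t"] elim(2) Kh[OF that] by auto
      then have "norm h \<le> (\<Sum>b\<in>(Basis::'e set). r)"
        by (intro order_trans[OF norm_le_l1] sum_mono) auto
      also have "\<dots> < \<rho>" using \<rho> by (simp add: r_def)
      finally have "((\<lambda>m. (\<Prod>b\<in>Basis. (h \<bullet> b) ^ m b) *\<^sub>R c m) has_sum g (a + h)) multi_indices"
        by (rule series)
      then have "((\<lambda>m. complex_of_real ((\<Prod>b\<in>Basis. (h \<bullet> b) ^ m b) *\<^sub>R c m)) has_sum of_real (g (a + h))) multi_indices"
        by (rule has_sum_of_real)
      also have "(\<lambda>m. complex_of_real ((\<Prod>b\<in>Basis. (h \<bullet> b) ^ m b) *\<^sub>R c m)) =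
          (\<lambda>m. (\<Prod>b\<in>Basis. K b (of_real t) ^ m b) * of_real (c m))"
        by (auto simp: Kh)
      finally show ?case unfolding G_def h_def by (auto dest: infsumI)
    qed
  qed
  ultimately show ?thesis by (rule real_analytic_atI)
qed

text \<open>Split the power series into the finitely many terms of total degree at most 1, which form a
  polynomial, and a remainder that is quadratically small by comparison with the majorant.\<close>

lemma real_analytic_on_imp_differentiable:
  fixes g :: "'e::euclidean_space \<Rightarrow> real"
  assumes "g real_analytic_on S" and "a \<in> S"
  shows "g differentiable (at a)"
proof -
  obtain c \<rho> where \<rho>: "\<rho> > 0"
    and series: "\<And>h. norm h < \<rho> \<Longrightarrow>
      ((\<lambda>m. (\<Prod>b\<in>Basis. (h \<bullet> b) ^ m b) *\<^sub>R c m) has_sum g (a + h)) multi_indices"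
    using assms unfolding real_analytic_on_def by blast
  define r where "r = \<rho> / (2 * DIM('e))"
  have r0: "r > 0" using \<rho> by (simp add: r_def)
  have "\<rho> / (2 * real DIM('e)) \<le> \<rho> / 2"
    using \<rho> DIM_positive[where 'a='e] by (intro divide_left_mono) (auto simp: Suc_leI)
  then have r\<rho>: "r < \<rho>" using \<rho> by (simp add: r_def)
  have summ: "(\<lambda>m. (\<Prod>b\<in>Basis. r ^ m b) * \<bar>c m\<bar>) summable_on multi_indices"
    using \<rho> r_def series by (rule real_analytic_on_abs_summable)
  \<comment> \<open>The multi-indices of the affine part of the series.\<close>
  define J where "J = {m \<in> multi_indices. (\<Sum>b\<in>(Basis::'e set). m b) \<le> 1}"
  define mon where "mon h m = (\<Prod>b\<in>Basis. (h \<bullet> b) ^ m b) *\<^sub>R c m" for h m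
  have "J \<subseteq> Basis \<rightarrow>\<^sub>E {0,1}"
  proof
    fix m assume m: "m \<in> J"
    have "m b \<in> {0,1}" if "b \<in> Basis" for b
    proof -
      have "m b \<le> (\<Sum>b\<in>(Basis::'e set). m b)" using that by (intro member_le_sum) auto
      with m show ?thesis by (auto simp: J_def)
    qed
    with m show "m \<in> Basis \<rightarrow>\<^sub>E {0,1}" by (auto simp: J_def PiE_iff)
  qed
  moreover have "finite ((Basis :: 'e set) \<rightarrow>\<^sub>E {0, 1::nat})" by (intro finite_PiE) auto
  moreover have "J \<subseteq> multi_indices" by (auto simp: J_def)
  ultimately have J: "finite J" "J \<subseteq> multi_indices" by (auto dest: finite_subset)
  define p where "p h = (\<Sum>m\<in>J. mon h m)" for h
  define R where "R h = g (a + h) - p h" for h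
  define C where "C = (\<Sum>\<^sub>\<infinity>m\<in>multi_indices - J. (\<Prod>b\<in>Basis. r ^ m b) * \<bar>c m\<bar>)"
  have summJ: "(\<lambda>m. (\<Prod>b\<in>Basis. r ^ m b) * \<bar>c m\<bar>) summable_on multi_indices - J"
    using summ by (rule summable_on_subset_banach) auto
  have bound: "\<bar>R h\<bar> \<le> (norm h / r)\<^sup>2 * C" if h: "norm h \<le> r" for h
  proof -
    have "(mon h has_sum g (a + h)) multi_indices"
      unfolding mon_def by (rule series) (use h r\<rho> in simp)
    then have R: "(mon h has_sum R h) (multi_indices - J)"
      unfolding R_def p_def by (intro has_sum_Diff has_sum_finite J)
    have "norm (R h) \<le> (norm h / r)\<^sup>2 * C"
    proof (rule norm_infsum_le[OF R])
      show "((\<lambda>m. (norm h / r)\<^sup>2 * ((\<Prod>b\<in>Basis. r ^ m b) * \<bar>c m\<bar>)) has_sum (norm h / r)\<^sup>2 * C) (multi_indices - J)"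
        unfolding C_def by (intro has_sum_cmult_right has_sum_infsum summJ)
      fix m :: "'e \<Rightarrow> nat" assume m: "m \<in> multi_indices - J"
      define n where "n = (\<Sum>b\<in>(Basis::'e set). m b)"
      have n: "n \<ge> 2" using m by (auto simp: J_def n_def)
      have "\<bar>\<Prod>b\<in>Basis. (h \<bullet> b) ^ m b\<bar> \<le> (\<Prod>b\<in>(Basis::'e set). norm h ^ m b)"
        unfolding abs_prod power_abs by (intro prod_mono conjI power_mono) (auto simp: Basis_le_norm)
      also have "\<dots> = norm h ^ n" by (simp add: n_def power_sum)
      also have "\<dots> = (norm h / r) ^ n * r ^ n" using r0 by (simp add: power_divide)
      also have "\<dots> \<le> (norm h / r)\<^sup>2 * r ^ n"
        using h r0 n by (intro mult_right_mono power_decreasing) (auto simp: divide_simps)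
      also have "r ^ n = (\<Prod>b\<in>(Basis::'e set). r ^ m b)" by (simp add: n_def power_sum)
      finally show "norm (mon h m) \<le> (norm h / r)\<^sup>2 * ((\<Prod>b\<in>Basis. r ^ m b) * \<bar>c m\<bar>)"
        unfolding mon_def real_scaleR_def real_norm_def abs_mult mult.assoc[symmetric] by (intro mult_right_mono) auto
    qed
    then show ?thesis by simp
  qed
  have R0: "R 0 = 0" using bound[of 0] r0 by simp
  have "(R has_derivative (\<lambda>_. 0)) (at 0)"
  proof (rule has_derivativeI_sandwich[OF r0, where H = "\<lambda>h. norm h * (C / r\<^sup>2)"])
    show "norm (R h - R 0 - 0) / norm (h - 0) \<le> norm h * (C / r\<^sup>2)" if "h \<noteq> 0" "dist h 0 < r" for h
    proof -
      have "norm (R h - R 0 - 0) / norm (h - 0) \<le> (norm h / r)\<^sup>2 * C / norm h"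
        using bound[of h] that R0 by (auto intro!: divide_right_mono)
      also have "\<dots> = norm h * (C / r\<^sup>2)" using that by (simp add: power2_eq_square)
      finally show ?thesis .
    qed
    show "((\<lambda>h::'e. norm h * (C / r\<^sup>2)) \<longlongrightarrow> 0) (at 0)"
      using r0 by (auto intro!: tendsto_eq_intros)
  qed auto
  then have "R differentiable (at 0)" by (auto simp: differentiable_def)
  moreover have "p differentiable (at 0)"
  proof -
    have "(\<lambda>h. \<Prod>b\<in>Basis. (h \<bullet> b) ^ m b) differentiable (at (0::'e))" for m :: "'e \<Rightarrow> nat"
      unfolding differentiable_def by (rule exI) (auto intro!: derivative_eq_intros)
    then show ?thesis unfolding p_def mon_def using J(1) by (intro differentiable_sum ballI differentiable_scaleR) auto
  qed
  ultimately have "(\<lambda>h. R h + p h) differentiable (at 0)" by (rule differentiable_add)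
  then have "(\<lambda>h. g (a + h)) differentiable (at (a - a))" by (simp add: R_def)
  then have "((\<lambda>h. g (a + h)) \<circ> (\<lambda>x. x - a)) differentiable (at a)"
    by (intro differentiable_chain_at) auto
  then show ?thesis by (simp add: o_def)
qed

section \<open>The derivative of an analytic norm\<close>

locale analytic_plane =
  fixes \<phi> :: "real ^ 2 \<Rightarrow> 'a::real_normed_vector"
  assumes coordinates: "linear_coordinates \<phi>"
    and analytic: "(\<lambda>u. norm (\<phi> u)) real_analytic_on (- {0})"
begin

definition \<psi> :: "'a \<Rightarrow> real ^ 2" where "\<psi> = inv \<phi>"

lemma linear_\<phi>: "linear \<phi>" and bij_\<phi>: "bij \<phi>"
  using coordinates by (auto simp: linear_coordinates_def)

lemma \<phi>_\<psi> [simp]: "\<phi> (\<psi> x) = x"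
  using bij_\<phi> by (simp add: \<psi>_def bij_is_surj surj_f_inv_f)

lemma \<psi>_\<phi> [simp]: "\<psi> (\<phi> u) = u"
  using bij_\<phi> by (simp add: \<psi>_def bij_is_inj)

lemma \<psi>_eq_iff [simp]: "\<psi> x = \<psi> y \<longleftrightarrow> x = y"
  by (metis \<phi>_\<psi>)

lemma bounded_linear_\<phi>: "bounded_linear \<phi>"
  using linear_\<phi> by (simp add: linear_conv_bounded_linear)

lemma linear_\<psi>: "linear \<psi>"
  using linear_add[OF linear_\<phi>] linear_scale[OF linear_\<phi>] by (intro linearI) (metis \<phi>_\<psi> \<psi>_\<phi>)+

lemmas \<psi>_simps [simp] =
  linear_add[OF linear_\<psi>] linear_diff[OF linear_\<psi>] linear_scale[OF linear_\<psi>] linear_0[OF linear_\<psi>]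
  linear_neg[OF linear_\<psi>]

text \<open>The norm of \<open>\<phi> u\<close> attains a positive minimum on the compact Euclidean unit circle.\<close>

lemma bounded_linear_\<psi>: "bounded_linear \<psi>"
proof -
  have "continuous_on (sphere 0 1) (\<lambda>u. norm (\<phi> u))"
    by (intro continuous_intros linear_continuous_on bounded_linear_\<phi>)
  moreover have "sphere 0 1 \<noteq> ({} :: (real ^ 2) set)" by simp
  ultimately obtain u0 :: "real ^ 2" where u0: "u0 \<in> sphere 0 1" "\<And>u. u \<in> sphere 0 1 \<Longrightarrow> norm (\<phi> u0) \<le> norm (\<phi> u)"
    using continuous_attains_inf[OF compact_sphere] by metis
  have pos: "norm (\<phi> u0) > 0"
  proof -
    have "u0 \<noteq> 0" using u0(1) by auto
    then show ?thesis using \<psi>_\<phi> \<psi>_simps(4) by (metis zero_less_norm_iff)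
  qed
  have "norm (\<psi> x) \<le> norm x * (1 / norm (\<phi> u0))" for x
  proof (cases "\<psi> x = 0")
    case False
    have "norm (\<phi> u0) \<le> norm (\<phi> (\<psi> x /\<^sub>R norm (\<psi> x)))"
      using False by (intro u0(2)) simp
    also have "\<dots> = norm x / norm (\<psi> x)"
      by (simp add: linear_scale[OF linear_\<phi>] divide_inverse)
    finally show ?thesis using False pos by (simp add: field_simps)
  qed simp
  then show ?thesis
    by (intro bounded_linear_intro[where K = "1 / norm (\<phi> u0)"]) auto
qed

text \<open>The determinant in coordinates: an alternating form whose sign tells on which side of the line
  through \<open>0\<close> and \<open>x\<close> the point \<open>y\<close> lies.\<close>

definition \<omega> :: "'a \<Rightarrow> 'a \<Rightarrow> real" where
  "\<omega> x y = \<psi> x $ 1 * \<psi> y $ 2 - \<psi> x $ 2 * \<psi> y $ 1"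

lemma \<omega>_linear [simp]:
  "\<omega> (x + y) w = \<omega> x w + \<omega> y w" "\<omega> (x - y) w = \<omega> x w - \<omega> y w"
  "\<omega> (c *\<^sub>R x) w = c * \<omega> x w" "\<omega> (- x) w = - \<omega> x w" "\<omega> 0 w = 0"
  "\<omega> w (x + y) = \<omega> w x + \<omega> w y" "\<omega> w (x - y) = \<omega> w x - \<omega> w y"
  "\<omega> w (c *\<^sub>R x) = c * \<omega> w x" "\<omega> w (- x) = - \<omega> w x" "\<omega> w 0 = 0" "\<omega> w w = 0"
  by (simp_all add: \<omega>_def algebra_simps)

lemma \<omega>_commute: "\<omega> y x = - \<omega> x y"
  by (simp add: \<omega>_def)

lemma \<omega>_cramer: "\<omega> z w *\<^sub>R v = \<omega> v w *\<^sub>R z + \<omega> z v *\<^sub>R w"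
proof -
  have "\<psi> (\<omega> z w *\<^sub>R v) = \<psi> (\<omega> v w *\<^sub>R z + \<omega> z v *\<^sub>R w)"
    by (simp add: vec_eq_iff forall_2 \<omega>_def) (simp add: algebra_simps)
  then show ?thesis by (simp only: \<psi>_eq_iff)
qed

lemma continuous_\<omega>:
  assumes "continuous_on S f" "continuous_on S g"
  shows "continuous_on S (\<lambda>x. \<omega> (f x) (g x))"
  unfolding \<omega>_def
  by (intro continuous_intros bounded_linear.continuous_on[OF bounded_linear_\<psi>] assms)

lemma exists_\<omega>_pos:
  assumes "z \<noteq> 0" "k \<noteq> 0"
  obtains w where "k * \<omega> z w > 0"
proof -
  define w where "w = \<phi> (\<chi> i. if i = 1 then - (k * \<psi> z $ 2) else k * \<psi> z $ 1)"
  have "\<psi> z \<noteq> 0" using assms by (metis \<psi>_eq_iff \<psi>_simps(4))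
  then have "\<psi> z $ 1 \<noteq> 0 \<or> \<psi> z $ 2 \<noteq> 0" by (simp add: vec_eq_iff forall_2)
  then have "(\<psi> z $ 1)\<^sup>2 + (\<psi> z $ 2)\<^sup>2 > 0" by (auto intro: add_pos_nonneg add_nonneg_pos)
  moreover have "k * \<omega> z w = k\<^sup>2 * ((\<psi> z $ 1)\<^sup>2 + (\<psi> z $ 2)\<^sup>2)"
    by (simp add: \<omega>_def w_def power2_eq_square algebra_simps)
  ultimately have "k * \<omega> z w > 0" using assms by simp
  then show ?thesis by (rule that)
qed

lemma \<omega>_eq_0_imp_scaleR:
  assumes "\<omega> x y = 0" "x \<noteq> 0"
  obtains l where "y = l *\<^sub>R x"
proof -
  obtain w where w: "\<omega> x w > 0" using exists_\<omega>_pos[OF assms(2), of 1] by auto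
  have "\<omega> x w *\<^sub>R y = \<omega> y w *\<^sub>R x" using \<omega>_cramer[of x w y] assms by simp
  then have "y = (\<omega> y w / \<omega> x w) *\<^sub>R x"
    using w by (metis divideR_right less_numeral_extra(3) scaleR_scaleR divide_inverse_commute)
  then show ?thesis by (rule that)
qed

lemma in_span_iff_\<omega>:
  assumes "z \<noteq> 0" shows "x \<in> span {z} \<longleftrightarrow> \<omega> z x = 0"
  using assms by (auto simp: span_singleton elim: \<omega>_eq_0_imp_scaleR)

definition analytic_curve :: "(real \<Rightarrow> 'a) \<Rightarrow> real \<Rightarrow> bool" where
  "analytic_curve P s \<longleftrightarrow> (\<forall>i. real_analytic_at (\<lambda>t. \<psi> (P t) $ i) s)"

lemma analytic_curve_const [simp]: "analytic_curve (\<lambda>t. x) s"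
  by (simp add: analytic_curve_def)

lemma analytic_curve_add: "analytic_curve P s \<Longrightarrow> analytic_curve Q s \<Longrightarrow> analytic_curve (\<lambda>t. P t + Q t) s"
  by (simp add: analytic_curve_def real_analytic_at_add)

lemma analytic_curve_diff: "analytic_curve P s \<Longrightarrow> analytic_curve Q s \<Longrightarrow> analytic_curve (\<lambda>t. P t - Q t) s"
  by (simp add: analytic_curve_def real_analytic_at_diff)

lemma analytic_curve_scaleR:
  "real_analytic_at g s \<Longrightarrow> analytic_curve P s \<Longrightarrow> analytic_curve (\<lambda>t. g t *\<^sub>R P t) s"
  by (simp add: analytic_curve_def real_analytic_at_mult)

lemma analytic_curve_compose:
  "real_analytic_at g s \<Longrightarrow> analytic_curve P (g s) \<Longrightarrow> analytic_curve (\<lambda>t. P (g t)) s"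
  unfolding analytic_curve_def using real_analytic_at_compose[of g s "\<lambda>t. \<psi> (P t) $ _"] by simp

lemma real_analytic_at_norm:
  assumes "analytic_curve P s" "P s \<noteq> 0"
  shows "real_analytic_at (\<lambda>t. norm (P t)) s"
proof -
  have "real_analytic_at (\<lambda>t. norm (\<phi> (\<psi> (P t)))) s"
  proof (rule real_analytic_on_compose_curve[OF analytic])
    show "\<psi> (P s) \<in> - {0}" using assms(2) by (metis ComplI \<psi>_eq_iff \<psi>_simps(4) singletonD)
    show "real_analytic_at (\<lambda>t. \<psi> (P t) \<bullet> b) s" if "b \<in> Basis" for b
    proof -
      obtain i where "b = axis i 1" using \<open>b \<in> Basis\<close> by (auto simp: Basis_vec_def)
      then show ?thesis using assms(1) by (simp add: inner_axis analytic_curve_def)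
    qed
  qed
  then show ?thesis by simp
qed

text \<open>The derivative of the norm at \<open>x\<close>. It has dual norm 1 and attains its norm at \<open>x\<close>, so it is the
  supporting functional of the ball through \<open>x\<close>.\<close>

definition nd :: "'a \<Rightarrow> 'a \<Rightarrow> real" where
  "nd x = frechet_derivative norm (at x)"

lemma norm_has_derivative:
  assumes "x \<noteq> 0" shows "(norm has_derivative nd x) (at x)"
proof -
  have "\<psi> x \<in> - {0}" using assms by (metis ComplI \<psi>_eq_iff \<psi>_simps(4) singletonD)
  then have "(\<lambda>u. norm (\<phi> u)) differentiable (at (\<psi> x))"
    using analytic real_analytic_on_imp_differentiable by blast
  then have "((\<lambda>u. norm (\<phi> u)) \<circ> \<psi>) differentiable (at x)"
    by (rule differentiable_chain_at[OF bounded_linear_imp_differentiable[OF bounded_linear_\<psi>]])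
  then show ?thesis unfolding nd_def by (simp add: o_def frechet_derivative_works[symmetric])
qed

lemma bounded_linear_nd: "x \<noteq> 0 \<Longrightarrow> bounded_linear (nd x)"
  using norm_has_derivative has_derivative_bounded_linear by blast

lemma nd_simps:
  assumes "x \<noteq> 0"
  shows "nd x (u + v) = nd x u + nd x v" "nd x (u - v) = nd x u - nd x v"
    "nd x (c *\<^sub>R v) = c * nd x v" "nd x (- v) = - nd x v" "nd x 0 = 0"
  using bounded_linear.linear[OF bounded_linear_nd[OF assms]]
  by (simp_all add: linear_add linear_diff linear_scale linear_neg linear_0)

lemma norm_curve_has_derivative:
  assumes "(P has_vector_derivative v) (at s)" "P s \<noteq> 0"
  shows "((\<lambda>t. norm (P t)) has_real_derivative nd (P s) v) (at s)"
proof -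
  have "((norm \<circ> P) has_derivative (nd (P s) \<circ> (\<lambda>t. t *\<^sub>R v))) (at s)"
    using assms norm_has_derivative[of "P s"] unfolding has_vector_derivative_def
    by (intro diff_chain_at)
  then show ?thesis
    by (simp add: o_def nd_simps[OF assms(2)] has_field_derivative_def mult_commute_abs)
qed

lemma abs_nd_le:
  assumes "x \<noteq> 0" shows "\<bar>nd x v\<bar> \<le> norm v"
proof -
  have "((\<lambda>t. x + t *\<^sub>R v) has_vector_derivative v) (at 0)"
    by (auto intro!: derivative_eq_intros)
  from norm_curve_has_derivative[OF this] have
    "((\<lambda>t. norm (x + t *\<^sub>R v)) has_real_derivative nd x v) (at 0)" using assms by simp
  then have "((\<lambda>t. \<bar>(norm (x + t *\<^sub>R v) - norm x) / t\<bar>) \<longlongrightarrow> \<bar>nd x v\<bar>) (at 0)"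
    unfolding has_field_derivative_iff by (intro tendsto_rabs) simp
  moreover have "\<bar>(norm (x + t *\<^sub>R v) - norm x) / t\<bar> \<le> norm v" if "t \<noteq> 0" for t
    using norm_triangle_ineq3[of "x + t *\<^sub>R v" x] that by (simp add: abs_divide divide_simps mult.commute)
  ultimately show ?thesis
    by (intro tendsto_upperbound[where F = "at (0::real)"]) (auto simp: eventually_at_filter)
qed

lemma nd_le: "x \<noteq> 0 \<Longrightarrow> nd x v \<le> norm v"
  using abs_nd_le[of x v] by simp

lemma nd_self:
  assumes "x \<noteq> 0" shows "nd x x = norm x"
proof -
  have "((\<lambda>t. x + t *\<^sub>R x) has_vector_derivative x) (at 0)"
    by (auto intro!: derivative_eq_intros)
  from norm_curve_has_derivative[OF this] have
    "((\<lambda>t. norm (x + t *\<^sub>R x)) has_real_derivative nd x x) (at 0)" using assms by simp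
  moreover have "((\<lambda>t. (1 + t) * norm x) has_real_derivative norm x) (at 0)"
    by (auto intro!: derivative_eq_intros)
  moreover have ev: "\<forall>\<^sub>F t in nhds 0. norm (x + t *\<^sub>R x) = (1 + t) * norm x"
  proof -
    have "norm (x + t *\<^sub>R x) = (1 + t) * norm x" if "dist t 0 < 1" for t
    proof -
      have "x + t *\<^sub>R x = (1 + t) *\<^sub>R x" by (simp add: scaleR_left_distrib)
      then show ?thesis using that by simp
    qed
    then show ?thesis unfolding eventually_nhds_metric by (intro exI[of _ 1]) simp
  qed
  ultimately show ?thesis
    using DERIV_cong_ev[OF refl ev refl, of "norm x"] by (auto intro: DERIV_unique)
qed

text \<open>Strict convexity. If the supporting functional at \<open>x\<close> also attained its norm in another direction, the
  unit circle would contain the segment between the two unit vectors. The norm is analytic along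
  the line through that segment, which misses the origin, so it would be 1 on the whole line,
  although it is unbounded there.\<close>

lemma nd_extremal:
  assumes x: "x \<noteq> 0" and v: "v \<noteq> 0" and eq: "nd x v = norm v"
  shows "norm x *\<^sub>R v = norm v *\<^sub>R x"
proof -
  define x1 where "x1 = (1 / norm x) *\<^sub>R x"
  define v1 where "v1 = (1 / norm v) *\<^sub>R v"
  define q where "q t = x1 + t *\<^sub>R (v1 - x1)" for t
  have unit: "norm x1 = 1" "norm v1 = 1" using x v by (auto simp: x1_def v1_def)
  have nd1: "nd x x1 = 1" "nd x v1 = 1"
    using x v eq by (simp_all add: x1_def v1_def nd_simps nd_self)
  have ndq: "nd x (q t) = 1" for t using nd1 x by (simp add: q_def nd_simps)
  then have q0: "q t \<noteq> 0" for t using nd_simps(5)[OF x] by (metis zero_neq_one)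
  have an: "real_analytic_at (\<lambda>t. norm (q t) - 1) t" for t
    unfolding q_def
    by (intro real_analytic_at_diff real_analytic_at_norm analytic_curve_add analytic_curve_scaleR)
      (use q0 in \<open>auto simp: q_def\<close>)
  have one: "norm (q t) = 1" if "0 < t" "t < 1" for t
  proof (rule antisym)
    have "q t = (1 - t) *\<^sub>R x1 + t *\<^sub>R v1" by (simp add: q_def algebra_simps)
    then have "norm (q t) \<le> norm ((1 - t) *\<^sub>R x1) + norm (t *\<^sub>R v1)" by (metis norm_triangle_ineq)
    then show "norm (q t) \<le> 1" using that unit by simp
  next
    show "1 \<le> norm (q t)" using nd_le[OF x, of "q t"] ndq by simp
  qed
  have "norm (q t) - 1 = 0" for t
  proof (rule real_analytic_uncountable_zeros[where I = UNIV and g = "\<lambda>t. norm (q t) - 1"])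
    have "uncountable {0<..<1::real}" by (simp add: uncountable_open_interval)
    moreover have "{0<..<1} \<subseteq> {t \<in> UNIV. norm (q t) - 1 = 0}" using one by auto
    ultimately show "uncountable {t \<in> UNIV. norm (q t) - 1 = 0}" using countable_subset by blast
  qed (use an in auto)
  then have 1: "norm (q t) = 1" for t by simp
  have "\<bar>t\<bar> * norm (v1 - x1) \<le> 2" for t
  proof -
    have "norm (t *\<^sub>R (v1 - x1)) \<le> norm (q t) + norm x1"
      using norm_triangle_ineq4[of "q t" x1] by (simp add: q_def)
    then show ?thesis using 1 unit by simp
  qed
  \<comment> \<open>Any multiple larger than \<open>2 / norm (v1 - x1)\<close> contradicts the bound.\<close>
  from this[of "3 / norm (v1 - x1)"] have "v1 = x1" by (cases "v1 = x1") auto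
  then have "norm x *\<^sub>R norm v *\<^sub>R v1 = norm x *\<^sub>R norm v *\<^sub>R x1" by simp
  then show ?thesis using x v by (simp add: x1_def v1_def)
qed

lemma nd_extremal_eq:
  assumes "x \<noteq> 0" "nd x v = norm x" "norm v = norm x"
  shows "v = x"
proof -
  have "v \<noteq> 0" using assms by auto
  with nd_extremal[of x v] assms show ?thesis by simp
qed

lemma strict_triangle:
  assumes "\<omega> x y \<noteq> 0" shows "norm (x + y) < norm x + norm y"
proof (rule ccontr)
  assume "\<not> ?thesis"
  then have eq: "norm (x + y) = norm x + norm y" using norm_triangle_ineq[of x y] by simp
  have 0: "x \<noteq> 0" "y \<noteq> 0" using assms by auto
  then have s0: "x + y \<noteq> 0" using eq by (metis norm_eq_zero add_nonneg_eq_0_iff norm_ge_zero)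
  have "nd (x + y) x + nd (x + y) y = norm x + norm y"
    using nd_self[OF s0] eq by (simp add: nd_simps[OF s0])
  then have "nd (x + y) x = norm x"
    using nd_le[OF s0, of x] nd_le[OF s0, of y] by linarith
  from nd_extremal[OF s0 0(1) this] have "\<omega> (norm (x + y) *\<^sub>R x) y = \<omega> (norm x *\<^sub>R (x + y)) y" by simp
  then have "(norm (x + y) - norm x) * \<omega> x y = 0" by (simp add: algebra_simps)
  with assms eq 0 show False by simp
qed

text \<open>Two supporting functionals with a common non-zero null vector are proportional; as both have norm 1
  they agree up to sign, and strict convexity makes \<open>x\<close> and \<open>w\<close> parallel.\<close>

lemma nd_independent:
  assumes xw: "\<omega> x w \<noteq> 0" and u: "nd x u = 0" "nd w u = 0"
  shows "u = 0"
proof (rule ccontr)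
  assume u0: "u \<noteq> 0"
  have 0: "x \<noteq> 0" "w \<noteq> 0" using xw by auto
  have "\<omega> x u \<noteq> 0"
  proof
    assume "\<omega> x u = 0"
    then obtain l where l: "u = l *\<^sub>R x" using 0 \<omega>_eq_0_imp_scaleR by blast
    with u(1) 0 have "l = 0" by (simp add: nd_simps nd_self)
    with l u0 show False by simp
  qed
  then have "w = (1 / \<omega> x u) *\<^sub>R (\<omega> x u *\<^sub>R w)" by simp
  then obtain \<alpha> \<beta> where w: "w = \<alpha> *\<^sub>R x + \<beta> *\<^sub>R u"
    unfolding \<omega>_cramer[of x u w] by (metis scaleR_add_right scaleR_scaleR)
  have "nd w w = \<alpha> * nd w x" by (subst (2) w) (simp add: nd_simps[OF 0(2)] u)
  then have 1: "norm w = \<alpha> * nd w x" using nd_self 0 by simp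
  have 2: "nd x w = \<alpha> * norm x" by (subst w) (simp add: nd_simps[OF 0(1)] nd_self[OF 0(1)] u)
  have "norm w \<le> \<bar>\<alpha>\<bar> * norm x"
    using abs_nd_le[OF 0(2), of x] 1 by (metis abs_ge_self abs_mult mult_left_mono abs_ge_zero order_trans)
  then have "\<bar>nd x w\<bar> = norm w" using abs_nd_le[OF 0(1), of w] 2 by (simp add: abs_mult)
  then have "nd x w = norm w \<or> nd x (- w) = norm (- w)"
    using nd_simps(4)[OF 0(1), of w] by auto
  then have "norm x *\<^sub>R w = norm w *\<^sub>R x \<or> norm x *\<^sub>R (- w) = norm (- w) *\<^sub>R x"
    using nd_extremal 0 by (metis neg_equal_0_iff_equal)
  then have "norm x * \<omega> x w = 0"
    by (elim disjE) (drule arg_cong[of _ _ "\<omega> x"], simp)+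
  then show False using xw 0 by simp
qed

end

section \<open>Triangles with one side fixed\<close>

text \<open>The lengths of the other two sides of the non-degenerate triangles with one side of length \<open>c\<close>.\<close>

definition triangle_region :: "real \<Rightarrow> (real \<times> real) set" where
  "triangle_region c = {(a, b). \<bar>a - b\<bar> < c \<and> c < a + b}"

lemma open_triangle_region: "open (triangle_region c)"
  unfolding triangle_region_def case_prod_unfold
  by (intro open_Collect_conj open_Collect_less continuous_intros)

lemma triangle_region_iff:
  "(a, b) \<in> triangle_region c \<longleftrightarrow> b \<in> {\<bar>a - c\<bar><..<a + c}"
  "(a, b) \<in> triangle_region c \<longleftrightarrow> a \<in> {\<bar>b - c\<bar><..<b + c}"
  by (auto simp: triangle_region_def)

lemma triangle_region_pos: "(a, b) \<in> triangle_region c \<Longrightarrow> a > 0 \<and> b > 0"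
  by (auto simp: triangle_region_def)

context analytic_plane
begin

text \<open>The factor \<open>k\<close> selects the side of the line through \<open>0\<close> and \<open>z\<close>. Arbitrary values, rather than
  only \<open>1\<close> and \<open>- 1\<close>, allow \<open>k = \<omega> z x\<close> for the side that contains \<open>x\<close>.\<close>

definition half :: "'a \<Rightarrow> real \<Rightarrow> 'a set" where
  "half z k = {x. k * \<omega> z x > 0}"

definition dists :: "'a \<Rightarrow> 'a \<Rightarrow> real \<times> real" where
  "dists z x = (norm x, norm (x - z))"

lemma open_half: "open (half z k)"
  unfolding half_def by (intro open_Collect_less continuous_intros continuous_\<omega>)

lemma half_imp: "x \<in> half z k \<Longrightarrow> \<omega> z x \<noteq> 0"
  by (auto simp: half_def)

lemma half_nonzero: "x \<in> half z k \<Longrightarrow> x \<noteq> 0 \<and> x - z \<noteq> 0 \<and> z \<noteq> 0"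
  by (auto simp: half_def)

lemma dists_in_region:
  assumes "\<omega> z x \<noteq> 0" shows "dists z x \<in> triangle_region (norm z)"
proof -
  have "\<omega> x (z - x) \<noteq> 0" "\<omega> z (x - z) \<noteq> 0" "\<omega> x (- z) \<noteq> 0"
    using assms \<omega>_commute[of x z] by auto
  from this[THEN strict_triangle] show ?thesis
    by (auto simp: dists_def triangle_region_def norm_minus_commute[of z x])
qed

text \<open>For \<open>x = l z\<close> the three lengths are proportional to \<open>\<bar>l\<bar>\<close>, \<open>\<bar>l - 1\<bar>\<close> and \<open>1\<close>, and one of the triangle
  inequalities between these is an equality.\<close>

lemma dists_not_in_region:
  assumes "\<omega> z x = 0" "z \<noteq> 0" shows "dists z x \<notin> triangle_region (norm z)"
proof -
  obtain l where l: "x = l *\<^sub>R z" using assms \<omega>_eq_0_imp_scaleR by blast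
  then have "x - z = (l - 1) *\<^sub>R z" by (simp add: algebra_simps)
  then have 1: "dists z x = (\<bar>l\<bar> * norm z, \<bar>l - 1\<bar> * norm z)" by (simp add: dists_def l)
  show ?thesis
  proof
    assume "dists z x \<in> triangle_region (norm z)"
    then have "\<bar>\<bar>l\<bar> * norm z - \<bar>l - 1\<bar> * norm z\<bar> < norm z" "norm z < \<bar>l\<bar> * norm z + \<bar>l - 1\<bar> * norm z"
      by (auto simp: 1 triangle_region_def)
    then have "\<bar>\<bar>l\<bar> - \<bar>l - 1\<bar>\<bar> * norm z < 1 * norm z" "1 * norm z < (\<bar>l\<bar> + \<bar>l - 1\<bar>) * norm z"
      by (simp_all only: left_diff_distrib[symmetric] distrib_right[symmetric] abs_mult abs_norm_cancel mult_1)
    then have "\<bar>\<bar>l\<bar> - \<bar>l - 1\<bar>\<bar> < 1" "1 < \<bar>l\<bar> + \<bar>l - 1\<bar>"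
      using assms(2) by (simp_all only: mult_less_cancel_right_pos zero_less_norm_iff not_False_eq_True)
    then show False by linarith
  qed
qed

lemma dists_in_region_iff:
  "z \<noteq> 0 \<Longrightarrow> dists z x \<in> triangle_region (norm z) \<longleftrightarrow> \<omega> z x \<noteq> 0"
  using dists_in_region dists_not_in_region by blast

text \<open>The line \<open>s \<mapsto> s z + w\<close> projected radially to the circle of radius \<open>a\<close>. It runs analytically through
  the half of that circle on the side of \<open>w\<close>.\<close>

definition half_circle :: "'a \<Rightarrow> 'a \<Rightarrow> real \<Rightarrow> real \<Rightarrow> 'a" where
  "half_circle z w a s = (a / norm (s *\<^sub>R z + w)) *\<^sub>R (s *\<^sub>R z + w)"

context
  fixes z w :: 'a and k :: real
  assumes w: "k * \<omega> z w > 0"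
begin

lemma line_nonzero: "s *\<^sub>R z + w \<noteq> 0"
proof
  assume "s *\<^sub>R z + w = 0"
  then have "\<omega> z (s *\<^sub>R z + w) = 0" by simp
  then show False using w by simp
qed

lemma z_nonzero: "z \<noteq> 0" using w by auto

lemma norm_half_circle: "a > 0 \<Longrightarrow> norm (half_circle z w a s) = a"
  using line_nonzero by (simp add: half_circle_def)

lemma half_circle_in_half: "a > 0 \<Longrightarrow> half_circle z w a s \<in> half z k"
  using w line_nonzero[of s] by (simp add: half_circle_def half_def mult.left_commute)

lemma half_circle_surj:
  assumes "x \<in> half z k"
  obtains s where "x = half_circle z w (norm x) s"
proof -
  define t where "t = \<omega> z x / \<omega> z w"
  have t: "t > 0" using assms w unfolding half_def t_def
    by (auto simp: zero_less_divide_iff zero_less_mult_iff)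
  have "\<omega> z w \<noteq> 0" using w by auto
  then have "x = (1 / \<omega> z w) *\<^sub>R (\<omega> z w *\<^sub>R x)" by simp
  also have "\<dots> = (\<omega> x w / \<omega> z w) *\<^sub>R z + t *\<^sub>R w"
    unfolding \<omega>_cramer[of z w x] by (simp add: scaleR_add_right t_def)
  also have "\<dots> = t *\<^sub>R ((\<omega> x w / \<omega> z w / t) *\<^sub>R z + w)"
    using t by (simp add: scaleR_add_right)
  finally obtain s where x: "x = t *\<^sub>R (s *\<^sub>R z + w)" by blast
  then have "norm x = t * norm (s *\<^sub>R z + w)" using t by simp
  then have "x = half_circle z w (norm x) s" using line_nonzero[of s] unfolding half_circle_def by (subst x) simp
  then show ?thesis by (rule that)
qed

lemma analytic_curve_half_circle: "analytic_curve (half_circle z w a) s"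
  unfolding half_circle_def
  by (intro analytic_curve_scaleR analytic_curve_add real_analytic_at_divide real_analytic_at_norm
      real_analytic_at_const real_analytic_at_ident analytic_curve_const)
    (simp_all add: line_nonzero)

text \<open>The velocity \<open>U\<close> of the half-circle is non-zero and annihilated by the derivative of the norm at the
  current point \<open>x\<close>. If the derivative at \<open>x - z\<close> annihilated it too, \<open>x\<close> and \<open>z\<close> would be parallel.\<close>

lemma half_circle_distance_has_derivative:
  assumes a: "a > 0"
  obtains d where "((\<lambda>s. norm (half_circle z w a s - z)) has_real_derivative d) (at s)" and "d \<noteq> 0"
proof -
  define q where "q = s *\<^sub>R z + w"
  have q0: "q \<noteq> 0" unfolding q_def by (rule line_nonzero)
  define n' where "n' = nd q z"
  define U where "U = (a / norm q) *\<^sub>R z - (a * n' / (norm q)\<^sup>2) *\<^sub>R q"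
  define x where "x = half_circle z w a s"
  have x: "x \<in> half z k" "x \<noteq> 0" "x - z \<noteq> 0"
    using half_circle_in_half[OF a] half_nonzero unfolding x_def by blast+
  have line: "((\<lambda>s. s *\<^sub>R z + w) has_vector_derivative z) (at s)"
    by (auto intro!: derivative_eq_intros)
  have n: "((\<lambda>s. norm (s *\<^sub>R z + w)) has_real_derivative n') (at s)"
    using norm_curve_has_derivative[OF line] q0 by (simp add: q_def n'_def)
  have coeff: "((\<lambda>s. a / norm (s *\<^sub>R z + w)) has_real_derivative - (a * n' / (norm q)\<^sup>2)) (at s)"
    using n q0 by (auto intro!: derivative_eq_intros simp: q_def power2_eq_square)
  have half_circle': "(half_circle z w a has_vector_derivative U) (at s)"
    unfolding half_circle_def[abs_def]
    using has_vector_derivative_scaleR[OF coeff line] by (simp add: U_def q_def)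
  have "((\<lambda>s. norm (half_circle z w a s)) has_real_derivative nd x U) (at s)"
    using norm_curve_has_derivative[OF half_circle'] x by (simp add: x_def)
  then have xU: "nd x U = 0" unfolding norm_half_circle[OF a] by (rule DERIV_unique) simp
  have "((\<lambda>s. half_circle z w a s - z) has_vector_derivative U) (at s)"
    using half_circle' by (auto intro!: derivative_eq_intros)
  from norm_curve_has_derivative[OF this] x
  have d: "((\<lambda>s. norm (half_circle z w a s - z)) has_real_derivative nd (x - z) U) (at s)"
    by (simp add: x_def)
  moreover have "nd (x - z) U \<noteq> 0"
  proof
    assume "nd (x - z) U = 0"
    moreover have "\<omega> x (x - z) \<noteq> 0" using half_imp[OF x(1)] \<omega>_commute[of x z] by simp
    ultimately have "U = 0" using xU nd_independent by blast
    then have "\<omega> z U = 0" by simp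
    then have "n' = 0" using a w q0 by (auto simp: U_def q_def)
    with \<open>U = 0\<close> have "z = 0" using a q0 by (simp add: U_def)
    then show False using z_nonzero by simp
  qed
  ultimately show ?thesis by (rule that)
qed

lemma half_circle_distance_isCont: "a > 0 \<Longrightarrow> isCont (\<lambda>s. norm (half_circle z w a s - z)) s"
  using half_circle_distance_has_derivative DERIV_isCont by metis

lemma inj_half_circle_distance:
  assumes a: "a > 0" shows "inj (\<lambda>s. norm (half_circle z w a s - z))"
proof -
  define h where "h s = norm (half_circle z w a s - z)" for s
  have "h s \<noteq> h t" if st: "s < t" for s t
  proof
    assume eq: "h s = h t"
    have "\<forall>u. \<exists>d. (h has_real_derivative d) (at u) \<and> d \<noteq> 0"
      unfolding h_def using half_circle_distance_has_derivative[OF a] by metis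
    then obtain D where D: "\<And>u. (h has_real_derivative D u) (at u)" "\<And>u. D u \<noteq> 0" by metis
    obtain u where "h t - h s = (t - s) * D u"
      using MVT2[OF st, of h D] D(1) by blast
    with eq st D(2) show False by simp
  qed
  then have "inj h" by (metis injI linorder_neqE)
  then show ?thesis by (simp add: h_def[abs_def])
qed

end

lemma half_circle_limit:
  assumes w: "k * \<omega> z w > 0"
  shows "((\<lambda>s. norm (half_circle z w a s - y)) \<longlongrightarrow> norm ((a / norm z) *\<^sub>R z - y)) at_top"
proof -
  have z: "z \<noteq> 0" using w by auto
  have "((\<lambda>s. z + inverse s *\<^sub>R w) \<longlongrightarrow> z + 0 *\<^sub>R w) at_top"
    by (intro tendsto_intros tendsto_inverse_0_at_top filterlim_ident)
  then have "((\<lambda>s. norm ((a / norm (z + inverse s *\<^sub>R w)) *\<^sub>R (z + inverse s *\<^sub>R w) - y)) \<longlongrightarrow>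
      norm ((a / norm z) *\<^sub>R z - y)) at_top"
    using z by (intro tendsto_intros) auto
  moreover have "\<forall>\<^sub>F s in at_top. norm ((a / norm (z + inverse s *\<^sub>R w)) *\<^sub>R (z + inverse s *\<^sub>R w) - y) =
      norm (half_circle z w a s - y)"
    using eventually_gt_at_top[of 0]
  proof eventually_elim
    case (elim s)
    then have 1: "s *\<^sub>R z + w = s *\<^sub>R (z + inverse s *\<^sub>R w)" by (simp add: scaleR_add_right)
    show ?case unfolding half_circle_def 1 using elim by simp
  qed
  ultimately show ?thesis by (rule Lim_transform_eventually)
qed

text \<open>Along the half-circle the distance to \<open>z\<close> tends to the two extreme values \<open>\<bar>a - norm z\<bar>\<close> and \<open>a + norm z\<close>
  at the two ends, and it takes every value in between.\<close>

lemma half_circle_distance_surj: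
  assumes w: "k * \<omega> z w > 0" and ab: "(a, b) \<in> triangle_region (norm z)"
  shows "\<exists>s. norm (half_circle z w a s - z) = b"
proof -
  have a: "a > 0" using ab triangle_region_pos by blast
  have z: "z \<noteq> 0" using w by auto
  define h where "h s = norm (half_circle z w a s - z)" for s
  have cont: "continuous_on S h" for S
    unfolding h_def using half_circle_distance_isCont[OF w a] by (simp add: continuous_at_imp_continuous_on)
  have "(h \<longlongrightarrow> norm ((a / norm z) *\<^sub>R z - z)) at_top"
    unfolding h_def by (rule half_circle_limit[OF w])
  moreover have "norm ((a / norm z) *\<^sub>R z - z) = \<bar>a - norm z\<bar>"
  proof -
    have "(a / norm z) *\<^sub>R z - z = ((a - norm z) / norm z) *\<^sub>R z"
      using z by (simp add: diff_divide_distrib scaleR_left_diff_distrib)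
    then show ?thesis using z by simp
  qed
  moreover have "\<bar>a - norm z\<bar> < b" using ab triangle_region_iff(1) by simp
  ultimately have "\<forall>\<^sub>F s in at_top. h s < b" by (simp add: order_tendsto_iff)
  then obtain s1 where s1: "h s1 < b" using eventually_happens'[OF trivial_limit_at_top_linorder] by blast
  have "((\<lambda>s. norm (half_circle (-z) w a s - z)) \<longlongrightarrow> norm ((a / norm (-z)) *\<^sub>R (-z) - z)) at_top"
    by (rule half_circle_limit[of "-k"]) (use w in simp)
  moreover have "half_circle (-z) w a s = half_circle z w a (-s)" for s by (simp add: half_circle_def)
  moreover have "norm ((a / norm (-z)) *\<^sub>R (-z) - z) = a + norm z"
  proof -
    have "(a / norm (-z)) *\<^sub>R (-z) - z = (- ((a + norm z) / norm z)) *\<^sub>R z"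
      using z by (simp add: add_divide_distrib scaleR_left_distrib scaleR_left_diff_distrib)
    then show ?thesis using z a by simp
  qed
  moreover have "b < a + norm z" using ab triangle_region_iff(1) by simp
  ultimately have "\<forall>\<^sub>F s in at_top. b < h (- s)" by (simp add: order_tendsto_iff h_def)
  then obtain s2 where s2: "b < h (- s2)" using eventually_happens'[OF trivial_limit_at_top_linorder] by blast
  have "connected (range h)" using cont by (intro connected_continuous_image) auto
  then have "b \<in> range h" using s1 s2 by (meson connectedD_interval less_imp_le rangeI)
  then show ?thesis by (auto simp: h_def)
qed

text \<open>The third vertex of the triangle with base from \<open>0\<close> to \<open>z\<close> and prescribed distances to \<open>0\<close> and \<open>z\<close>, on a
  given side of the base.\<close>

definition apex :: "'a \<Rightarrow> real \<Rightarrow> real \<times> real \<Rightarrow> 'a" where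
  "apex z k p = (THE x. x \<in> half z k \<and> dists z x = p)"

lemma inj_on_dists:
  assumes "x \<in> half z k" "y \<in> half z k" "dists z x = dists z y"
  shows "x = y"
proof -
  obtain w where w: "k * \<omega> z w > 0" using assms(1) by (auto simp: half_def)
  have x0: "norm x > 0" and eq: "norm y = norm x" using assms half_nonzero by (auto simp: dists_def)
  obtain s where s: "x = half_circle z w (norm x) s" using half_circle_surj[OF w assms(1)] .
  obtain t where t: "y = half_circle z w (norm y) t" using half_circle_surj[OF w assms(2)] .
  have "norm (half_circle z w (norm x) s - z) = norm (half_circle z w (norm x) t - z)"
    using assms(3) s t eq by (simp add: dists_def)
  then have "s = t" using inj_half_circle_distance[OF w x0] by (simp add: inj_def)
  then show ?thesis using s t eq by simp
qed

lemma apex_unique: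
  assumes "x \<in> half z k" "dists z x = p" shows "apex z k p = x"
  unfolding apex_def
proof (rule the_equality)
  show "x \<in> half z k \<and> dists z x = p" using assms by blast
  show "y = x" if "y \<in> half z k \<and> dists z y = p" for y
    using inj_on_dists[of y z k x] that assms by simp
qed

lemma apex_works:
  assumes "p \<in> triangle_region (norm z)" "z \<noteq> 0" "k \<noteq> 0"
  shows "apex z k p \<in> half z k" and "dists z (apex z k p) = p"
proof -
  obtain a b where p: "p = (a, b)" by (cases p)
  obtain w where w: "k * \<omega> z w > 0" using exists_\<omega>_pos assms by blast
  obtain s where s: "norm (half_circle z w a s - z) = b" using half_circle_distance_surj w assms p by blast
  have a: "a > 0" using assms(1) p triangle_region_pos by blast
  have 1: "half_circle z w a s \<in> half z k" "dists z (half_circle z w a s) = p"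
    using half_circle_in_half[OF w a] norm_half_circle[OF w a] s p by (auto simp: dists_def)
  then have "apex z k p = half_circle z w a s" by (rule apex_unique)
  with 1 show "apex z k p \<in> half z k" "dists z (apex z k p) = p" by auto
qed

lemma norm_apex:
  assumes "(a, b) \<in> triangle_region (norm z)" "z \<noteq> 0" "k \<noteq> 0"
  shows "norm (apex z k (a, b)) = a" "norm (apex z k (a, b) - z) = b"
  using apex_works(2)[OF assms] by (auto simp: dists_def)

text \<open>The point reflection that exchanges \<open>0\<close> and \<open>z\<close> exchanges the two side lengths and the two
  sides of the base. It reduces questions on the first side length to the second.\<close>

lemma apex_swap:
  assumes "(a, b) \<in> triangle_region (norm z)" "z \<noteq> 0" "k \<noteq> 0"
  shows "apex z k (a, b) = z - apex z (- k) (b, a)"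
proof (rule apex_unique)
  have ba: "(b, a) \<in> triangle_region (norm z)" "- k \<noteq> 0"
    using assms by (auto simp: triangle_region_def)
  show "z - apex z (- k) (b, a) \<in> half z k"
    using apex_works(1)[OF ba(1) assms(2) ba(2)] by (simp add: half_def)
  show "dists z (z - apex z (- k) (b, a)) = (a, b)"
    using norm_apex[OF ba(1) assms(2) ba(2)] by (simp add: dists_def norm_minus_commute)
qed

lemma analytic_curve_cong:
  assumes "analytic_curve P s" "\<forall>\<^sub>F t in nhds s. Q t = P t"
  shows "analytic_curve Q s"
  unfolding analytic_curve_def
proof
  fix i
  show "real_analytic_at (\<lambda>t. \<psi> (Q t) $ i) s"
  proof (rule real_analytic_at_cong)
    show "real_analytic_at (\<lambda>t. \<psi> (P t) $ i) s" using assms(1) by (simp add: analytic_curve_def)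
    show "\<forall>\<^sub>F t in nhds s. \<psi> (Q t) $ i = \<psi> (P t) $ i" using assms(2) by eventually_elim simp
  qed
qed

lemma eventually_triangle_region:
  assumes "(a, b) \<in> triangle_region c"
  shows "\<forall>\<^sub>F t in nhds b. (a, t) \<in> triangle_region c" "\<forall>\<^sub>F t in nhds a. (t, b) \<in> triangle_region c"
proof -
  have "b \<in> {\<bar>a - c\<bar><..<a + c}" using assms by (simp only: triangle_region_iff(1))
  then show "\<forall>\<^sub>F t in nhds b. (a, t) \<in> triangle_region c"
    unfolding triangle_region_iff(1) by (intro eventually_nhds_in_open) auto
  have "a \<in> {\<bar>b - c\<bar><..<b + c}" using assms by (simp only: triangle_region_iff(2))
  then show "\<forall>\<^sub>F t in nhds a. (t, b) \<in> triangle_region c"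
    unfolding triangle_region_iff(2) by (intro eventually_nhds_in_open) auto
qed

text \<open>With the distance to \<open>0\<close> fixed, the apex moves on a half-circle, and its parameter is the inverse of
  the distance to \<open>z\<close>, an analytic function with non-zero derivative.\<close>

lemma analytic_curve_apex_snd:
  assumes ab: "(a, b) \<in> triangle_region (norm z)" and z: "z \<noteq> 0" and k: "k \<noteq> 0"
  shows "analytic_curve (\<lambda>b. apex z k (a, b)) b"
proof -
  have a: "a > 0" using ab triangle_region_pos by blast
  obtain w where w: "k * \<omega> z w > 0" using exists_\<omega>_pos z k by blast
  define h where "h s = norm (half_circle z w a s - z)" for s
  have "inj h" using inj_half_circle_distance[OF w a] by (simp add: h_def[abs_def])
  then have h_inj: "inv h (h s) = s" for s by simp
  have h_surj: "h (inv h b) = b" if "(a, b) \<in> triangle_region (norm z)" for b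
    using half_circle_distance_surj[OF w that] unfolding h_def[symmetric] by (metis f_inv_into_f rangeI)
  define s where "s = inv h b"
  have hs: "h s = b" using h_surj ab by (simp add: s_def)
  have half_circle0: "half_circle z w a s - z \<noteq> 0"
    using half_circle_in_half[OF w a] half_nonzero by blast
  obtain d where d: "(h has_real_derivative d) (at s)" "d \<noteq> 0"
    using half_circle_distance_has_derivative[OF w a] unfolding h_def by blast
  have "real_analytic_at (inv h) (h s)"
  proof (rule real_analytic_at_inverse[OF _ d, where e = 1])
    show "real_analytic_at h s" unfolding h_def
      by (intro real_analytic_at_norm analytic_curve_diff analytic_curve_half_circle[OF w] analytic_curve_const half_circle0)
    show "isCont h t" for t unfolding h_def by (rule half_circle_distance_isCont[OF w a])
    show "\<forall>\<^sub>F b in nhds (h s). h (inv h b) = b"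
      unfolding hs using eventually_triangle_region(1)[OF ab] by eventually_elim (rule h_surj)
  qed (use h_inj in auto)
  then have "analytic_curve (\<lambda>b. half_circle z w a (inv h b)) b"
    unfolding hs by (rule analytic_curve_compose) (rule analytic_curve_half_circle[OF w])
  moreover have "\<forall>\<^sub>F b in nhds b. apex z k (a, b) = half_circle z w a (inv h b)"
    using eventually_triangle_region(1)[OF ab]
  proof eventually_elim
    case (elim b)
    show ?case
      by (rule apex_unique) (use half_circle_in_half[OF w a] norm_half_circle[OF w a] h_surj[OF elim] in \<open>auto simp: dists_def h_def\<close>)
  qed
  ultimately show ?thesis by (rule analytic_curve_cong)
qed

lemma analytic_curve_apex_fst:
  assumes ab: "(a, b) \<in> triangle_region (norm z)" and z: "z \<noteq> 0" and k: "k \<noteq> 0"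
  shows "analytic_curve (\<lambda>a. apex z k (a, b)) a"
proof (rule analytic_curve_cong)
  have "(b, a) \<in> triangle_region (norm z)" using ab by (auto simp: triangle_region_def)
  then show "analytic_curve (\<lambda>a. z - apex z (- k) (b, a)) a"
    using z k by (intro analytic_curve_diff analytic_curve_const analytic_curve_apex_snd) auto
  show "\<forall>\<^sub>F t in nhds a. apex z k (t, b) = z - apex z (- k) (b, t)"
    using eventually_triangle_region(2)[OF ab] by eventually_elim (use apex_swap z k in blast)
qed

lemma continuous_dists: "continuous_on S (dists z)"
  unfolding dists_def by (intro continuous_intros)

lemma image_dists_half:
  assumes "z \<noteq> 0" "k \<noteq> 0" shows "dists z ` half z k = triangle_region (norm z)"
proof
  show "dists z ` half z k \<subseteq> triangle_region (norm z)" using dists_in_region half_imp by blast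
  show "triangle_region (norm z) \<subseteq> dists z ` half z k"
  proof
    fix p assume "p \<in> triangle_region (norm z)"
    from apex_works[OF this assms] show "p \<in> dists z ` half z k" by (metis imageI)
  qed
qed

text \<open>The apex map inverts an injective continuous map between open subsets of planes, so it is continuous by
  invariance of domain.\<close>

lemma continuous_on_apex:
  assumes z: "z \<noteq> 0" and k: "k \<noteq> 0"
  shows "continuous_on (triangle_region (norm z)) (apex z k)"
proof -
  define S where "S = \<phi> -` half z k"
  have cont\<phi>: "continuous_on T \<phi>" for T by (rule linear_continuous_on[OF bounded_linear_\<phi>])
  have "open S" unfolding S_def by (rule open_vimage[OF open_half cont\<phi>])
  moreover have "continuous_on S (\<lambda>u. dists z (\<phi> u))"
    by (rule continuous_on_compose2[OF continuous_dists cont\<phi>]) auto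
  moreover have "\<psi> (apex z k (dists z (\<phi> u))) = u" if "u \<in> S" for u
    using that apex_unique[of "\<phi> u" z k] by (simp add: S_def)
  ultimately have "continuous_on ((\<lambda>u. dists z (\<phi> u)) ` S) (\<lambda>p. \<psi> (apex z k p))"
    by (intro continuous_on_inverse_open) auto
  moreover have "(\<lambda>u. dists z (\<phi> u)) ` S = triangle_region (norm z)"
  proof -
    have "\<phi> ` S = half z k" unfolding S_def using bij_\<phi> by (simp add: bij_is_surj)
    then show ?thesis using image_dists_half[OF z k] by (metis image_image)
  qed
  ultimately have "continuous_on (triangle_region (norm z)) (\<lambda>p. \<phi> (\<psi> (apex z k p)))"
    by (intro continuous_on_compose2[OF cont\<phi>]) auto
  then show ?thesis by simp
qed

definition dists_deriv :: "'a \<Rightarrow> 'a \<Rightarrow> 'a \<Rightarrow> real \<times> real" where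
  "dists_deriv z x v = (nd x v, nd (x - z) v)"

lemma dists_has_derivative:
  assumes "x \<in> half z k" shows "(dists z has_derivative dists_deriv z x) (at x)"
proof -
  have x: "x \<noteq> 0" "x - z \<noteq> 0" using half_nonzero[OF assms] by auto
  have "((norm \<circ> (\<lambda>x. x - z)) has_derivative (nd (x - z) \<circ> (\<lambda>v. v))) (at x)"
    by (intro diff_chain_at norm_has_derivative x) (auto intro!: derivative_eq_intros)
  then show ?thesis
    unfolding dists_def[abs_def] dists_deriv_def[abs_def] using norm_has_derivative[OF x(1)]
    by (intro has_derivative_Pair) (simp_all add: o_def)
qed

lemma dists_deriv_left_inverse:
  assumes "x \<in> half z k"
  obtains g where "bounded_linear g" "\<And>v. g (dists_deriv z x v) = v"
proof -
  have x: "x \<noteq> 0" "x - z \<noteq> 0" using half_nonzero[OF assms] by auto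
  have bl: "bounded_linear (\<lambda>u. dists_deriv z x (\<phi> u))"
    using bounded_linear_compose[OF has_derivative_bounded_linear[OF dists_has_derivative[OF assms]] bounded_linear_\<phi>] .
  have "inj (\<lambda>u. dists_deriv z x (\<phi> u))"
  proof (subst linear_injective_0)
    show "linear (\<lambda>u. dists_deriv z x (\<phi> u))" using bl by (rule bounded_linear.linear)
    show "\<forall>u. dists_deriv z x (\<phi> u) = 0 \<longrightarrow> u = 0"
    proof (intro allI impI)
      fix u assume "dists_deriv z x (\<phi> u) = 0"
      then have "nd x (\<phi> u) = 0" "nd (x - z) (\<phi> u) = 0" by (auto simp: dists_deriv_def zero_prod_def)
      moreover have "\<omega> x (x - z) \<noteq> 0" using half_imp[OF assms] \<omega>_commute[of x z] by simp
      ultimately have "\<phi> u = 0" using nd_independent by blast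
      then show "u = 0" using \<psi>_\<phi> \<psi>_simps(4) by metis
    qed
  qed
  then obtain g where g: "linear g" "g \<circ> (\<lambda>u. dists_deriv z x (\<phi> u)) = id"
    using linear_injective_left_inverse[OF bounded_linear.linear[OF bl]] by blast
  have "\<phi> (g (dists_deriv z x v)) = v" for v
    using fun_cong[OF g(2), of "\<psi> v"] by simp
  moreover have "bounded_linear (\<lambda>p. \<phi> (g p))"
    using g(1) by (intro bounded_linear_compose[OF bounded_linear_\<phi>]) (simp add: linear_conv_bounded_linear)
  ultimately show ?thesis by (intro that)
qed

lemma apex_differentiable:
  assumes p: "p \<in> triangle_region (norm z)" and z: "z \<noteq> 0" and k: "k \<noteq> 0"
  shows "apex z k differentiable (at p)"
proof -
  note A = apex_works[OF p z k]
  obtain g where g: "bounded_linear g" "\<And>v. g (dists_deriv z (apex z k p) v) = v"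
    using dists_deriv_left_inverse[OF A(1)] by metis
  have "(apex z k has_derivative g) (at p)"
  proof (rule has_derivative_inverse_basic[where g = "apex z k" and y = p, OF dists_has_derivative[OF A(1)] g(1) _ _ open_triangle_region p])
    show "continuous (at p) (apex z k)"
      using continuous_on_apex[OF z k] open_triangle_region p continuous_on_eq_continuous_at by blast
    show "dists z (apex z k q) = q" if "q \<in> triangle_region (norm z)" for q
      using apex_works(2)[OF that z k] .
  qed (use g(2) in auto)
  then show ?thesis by (auto simp: differentiable_def)
qed

end

section \<open>Zero sets in the space of side lengths\<close>

text \<open>Tonelli: almost all vertical sections are countable, hence null.\<close>

lemma countable_uncountable_sections_imp_negligible:
  fixes Z :: "(real \<times> real) set"
  assumes Z: "Z \<in> sets borel" and cnt: "countable {a. uncountable {b. (a, b) \<in> Z}}"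
  shows "negligible Z"
proof -
  have Z': "Z \<in> sets (lborel \<Otimes>\<^sub>M lborel)" using Z by (simp only: lborel_prod sets_lborel)
  have "AE a in lborel. a \<notin> {a. uncountable {b. (a, b) \<in> Z}}"
    by (intro AE_not_in countable_imp_null_set_lborel cnt)
  then have "AE a in lborel. emeasure lborel (Pair a -` Z) = 0"
  proof eventually_elim
    case (elim a)
    then have "countable {b. (a, b) \<in> Z}" by simp
    then have "countable (Pair a -` Z)" by (simp add: vimage_def)
    then show ?case by (intro emeasure_lborel_countable)
  qed
  then have "(\<integral>\<^sup>+a. emeasure lborel (Pair a -` Z) \<partial>lborel) = (\<integral>\<^sup>+a. 0 \<partial>(lborel :: real measure))"
    by (rule nn_integral_cong_AE)
  then have "emeasure (lborel \<Otimes>\<^sub>M lborel) Z = 0"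
    using lborel.emeasure_pair_measure_alt[OF Z'] by simp
  then have "Z \<in> null_sets lborel" using Z unfolding lborel_prod by (intro null_setsI) simp_all
  then show ?thesis by (simp add: negligible_iff_null_sets null_sets_completionI)
qed

text \<open>The idea is to spread zeros by moving along the two families of lines in turn. Let \<open>A\<close> be the set of
  \<open>a\<close> for which \<open>F a\<close> vanishes on its whole section \<open>I a\<close>. By the identity theorem on vertical lines \<open>A\<close> is
  uncountable, so it has a limit point \<open>a'\<close>. By the identity theorem on horizontal lines
  \<open>F\<close> vanishes along every horizontal line at a height in \<open>I a'\<close>. Any \<open>a\<close> at distance less than \<open>2 * c\<close> from \<open>a'\<close>
  has a section overlapping \<open>I a'\<close>, and so it belongs to \<open>A\<close>. Hence the limit points of \<open>A\<close> form an open and closed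
  subset of the positive half-line, and everything is covered. The lines \<open>a = a0\<close> and \<open>b = b0\<close> are left out of
  the hypotheses because in the application \<open>F\<close> is a difference of norms that is singular at \<open>(a0, b0)\<close>.\<close>

lemma separately_analytic_zero:
  fixes F :: "real \<Rightarrow> real \<Rightarrow> real"
  assumes c: "c > 0"
    and snd: "\<And>a b. (a, b) \<in> triangle_region c \<Longrightarrow> a \<noteq> a0 \<Longrightarrow> real_analytic_at (F a) b"
    and fst: "\<And>a b. (a, b) \<in> triangle_region c \<Longrightarrow> b \<noteq> b0 \<Longrightarrow> real_analytic_at (\<lambda>a. F a b) a"
    and unc: "uncountable {a. uncountable {b. (a, b) \<in> triangle_region c \<and> F a b = 0}}"
    and ab: "(a, b) \<in> triangle_region c" "a \<noteq> a0"
  shows "F a b = 0"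
proof -
  define I where "I a = {\<bar>a - c\<bar><..<a + c}" for a
  have region: "(a, b) \<in> triangle_region c \<longleftrightarrow> b \<in> I a" "(a, b) \<in> triangle_region c \<longleftrightarrow> a \<in> I b" for a b
    unfolding I_def by (rule triangle_region_iff)+
  have sym: "b \<in> I a \<longleftrightarrow> a \<in> I b" for a b using region by blast
  have I: "open (I a)" "connected (I a)" for a by (auto simp: I_def)
  define A where "A = {a. a > 0 \<and> a \<noteq> a0 \<and> (\<forall>b\<in>I a. F a b = 0)}"
  have in_A: "a \<in> A" if "a > 0" "a \<noteq> a0" "uncountable S" "S \<subseteq> I a" "\<And>b. b \<in> S \<Longrightarrow> F a b = 0" for a S
  proof -
    have "S \<subseteq> {b \<in> I a. F a b = 0}" using that by blast
    then have "uncountable {b \<in> I a. F a b = 0}" using \<open>uncountable S\<close> countable_subset by blast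
    then have "F a b = 0" if "b \<in> I a" for b
      using snd \<open>a \<noteq> a0\<close> region(1) I that by (intro real_analytic_uncountable_zeros[where I = "I a" and g = "F a"]) auto
    then show ?thesis using that by (simp add: A_def)
  qed
  have "uncountable A"
  proof
    assume "countable A"
    moreover have "{a. uncountable {b. (a, b) \<in> triangle_region c \<and> F a b = 0}} \<subseteq> insert a0 A"
    proof
      fix a assume a: "a \<in> {a. uncountable {b. (a, b) \<in> triangle_region c \<and> F a b = 0}}"
      then have "{b. (a, b) \<in> triangle_region c \<and> F a b = 0} \<noteq> {}" using countable_empty by force
      then have "a > 0" using triangle_region_pos by blast
      have "a \<in> A" if "a \<noteq> a0"
      proof (rule in_A[OF \<open>a > 0\<close> that])
        show "uncountable {b. (a, b) \<in> triangle_region c \<and> F a b = 0}" using a by simp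
        show "{b. (a, b) \<in> triangle_region c \<and> F a b = 0} \<subseteq> I a" using region(1) by blast
      qed simp
      then show "a \<in> insert a0 A" by blast
    qed
    ultimately have "countable {a. uncountable {b. (a, b) \<in> triangle_region c \<and> F a b = 0}}"
      by (meson countable_insert countable_subset)
    with unc show False by contradiction
  qed
  moreover have "A \<subseteq> {0<..}" by (auto simp: A_def)
  ultimately obtain a1 where a1: "a1 > 0" "a1 islimpt A"
    using uncountable_imp_islimpt[of "{0<..}" A] by auto
  have step: "a \<in> A" if a': "a' > 0" "a' islimpt A" and a: "a > 0" "a \<noteq> a0" "\<bar>a - a'\<bar> < 2 * c" for a a'
  proof -
    have zero: "F a b = 0" if b: "b \<in> I a'" "b \<noteq> b0" "a \<in> I b" for a b
    proof (rule real_analytic_zero_on_interval[where I = "I b" and g = "\<lambda>a. F a b"])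
      show "real_analytic_at (\<lambda>a. F a b) t" if "t \<in> I b" for t using fst region(2) b(2) that by blast
      have a'b: "a' \<in> I b" using b(1) sym by blast
      then show "a' \<in> I b" .
      have "\<forall>\<^sub>F t in at a'. t \<in> I b" using I(1) a'b by (rule eventually_at_in_open')
      then have "a' islimpt (A \<inter> I b)" by (rule islimpt_Int_eventually[OF a'(2)])
      then show "a' islimpt {t. F t b = 0}"
        by (rule islimpt_subset) (use sym in \<open>auto simp: A_def\<close>)
    qed (use I b in auto)
    \<comment> \<open>The sections of \<open>a\<close> and \<open>a'\<close> overlap in this interval.\<close>
    define lo hi where "lo = max \<bar>a - c\<bar> \<bar>a' - c\<bar>" and "hi = min (a + c) (a' + c)"
    have "lo < hi" using a a' c by (auto simp: lo_def hi_def)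
    then have "uncountable ({lo<..<hi} - {b0})" by (simp add: uncountable_minus_countable uncountable_open_interval)
    then show ?thesis
    proof (rule in_A[rotated 2])
      show "{lo<..<hi} - {b0} \<subseteq> I a" by (auto simp: I_def lo_def hi_def)
      fix b assume b: "b \<in> {lo<..<hi} - {b0}"
      then have "b \<in> I a'" "b \<in> I a" by (auto simp: I_def lo_def hi_def)
      with b sym show "F a b = 0" by (intro zero) auto
    qed (use a in auto)
  qed
  define L where "L = {a. a > 0 \<and> a islimpt A}"
  have "L = {0<..}"
  proof -
    have near: "a islimpt A" if "a' > 0" "a' islimpt A" "a > 0" "\<bar>a - a'\<bar> < 2 * c" for a a'
    proof -
      define V where "V = {0<..} \<inter> {a' - 2 * c<..<a' + 2 * c}"
      have "open V" by (auto simp: V_def)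
      then have "a islimpt V" using that by (intro interior_limit_point) (auto simp: interior_open V_def)
      then have "a islimpt (insert a0 (V - {a0}))" by (rule islimpt_subset) auto
      then have "a islimpt (V - {a0})" by (simp only: islimpt_insert)
      moreover have "V - {a0} \<subseteq> A"
      proof
        fix x assume "x \<in> V - {a0}"
        with that(1,2) show "x \<in> A" by (intro step[of a']) (auto simp: V_def abs_less_iff)
      qed
      ultimately show ?thesis by (rule islimpt_subset)
    qed
    have sub: "L \<subseteq> {0<..}" by (auto simp: L_def)
    have "\<exists>e>0. \<forall>x'\<in>{0<..}. dist x' a < e \<longrightarrow> x' \<in> L" if a: "a \<in> L" for a
    proof (intro exI conjI ballI impI)
      fix t assume "t \<in> {0::real<..}" "dist t a < 2 * c"
      then show "t \<in> L" using near[of a t] a unfolding L_def dist_real_def by simp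
    qed (use c in simp)
    then have "openin (top_of_set {0<..}) L"
      unfolding openin_euclidean_subtopology_iff using sub by blast
    moreover have "closedin (top_of_set {0<..}) L"
    proof -
      have "L = {0<..} \<inter> {t. t islimpt A}" by (auto simp: L_def)
      then show ?thesis by (simp only: closedin_closed_Int[OF closed_limpts])
    qed
    moreover have "L \<noteq> {}" using a1 by (auto simp: L_def)
    ultimately show ?thesis using connected_Ioi[of "0::real"] unfolding connected_clopen by blast
  qed
  moreover have "a > 0" using ab triangle_region_pos by blast
  ultimately have "a islimpt A" by (auto simp: L_def)
  with \<open>a > 0\<close> ab(2) c have "a \<in> A" by (intro step[of a]) auto
  then show ?thesis using ab region(1) by (simp add: A_def)
qed

context analytic_plane
begin

text \<open>Both sides of the equation defining \<open>E\<close> depend on \<open>x\<close> only through the side lengths \<open>dists z x\<close>, and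
  as functions of these they are separately analytic off the side lengths of \<open>y\<close>. So their set of agreement
  is null or everything in the space of side lengths, and the differentiable apex map carries null
  sets to null sets.\<close>

lemma equidistance_null_or_everywhere:
  fixes z z' y y' :: 'a
  assumes nz: "z \<noteq> 0" "k \<noteq> 0" "k' \<noteq> 0" and z': "norm z' = norm z"
    and y: "y \<in> half z k" and y': "y' \<in> half z' k'" "dists z' y' = dists z y"
  defines "E \<equiv> {x \<in> half z k. norm (apex z' k' (dists z x) - y') = norm (x - y)}"
  shows "negligible (\<phi> -` E) \<or> E = half z k"
proof -
  define c where "c = norm z"
  have c: "c > 0" using nz by (simp add: c_def)
  have z'0: "z' \<noteq> 0" using z' nz by auto
  define D where "D = triangle_region c"
  define P where "P = apex z k"
  define P' where "P' = apex z' k'"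
  define F where "F a b = norm (P' (a, b) - y') - norm (P (a, b) - y)" for a b
  define Z where "Z = {p \<in> D. F (fst p) (snd p) = 0}"
  obtain a0 b0 where p0: "dists z y = (a0, b0)" by (cases "dists z y")
  have P: "P p \<in> half z k" "dists z (P p) = p" if "p \<in> D" for p
    using apex_works[of p z k] that nz unfolding P_def D_def c_def by auto
  have P': "P' p \<in> half z' k'" "dists z' (P' p) = p" if "p \<in> D" for p
    using apex_works[of p z' k'] that nz z'0 z' unfolding P'_def D_def c_def by auto
  have ne: "P p - y \<noteq> 0" "P' p - y' \<noteq> 0" if "p \<in> D" "p \<noteq> (a0, b0)" for p
    using P(2)[OF that(1)] P'(2)[OF that(1)] that(2) p0 y'(2) by auto
  have Pcont: "continuous_on D P" "continuous_on D P'"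
    using continuous_on_apex[of z k] continuous_on_apex[of z' k'] nz z'0 z'
    unfolding P_def P'_def D_def c_def by auto
  have Fcont: "continuous_on D (\<lambda>p. F (fst p) (snd p))"
    unfolding F_def prod.collapse by (intro continuous_intros Pcont)
  have E: "E = P ` Z"
  proof (intro equalityI subsetI)
    fix x assume x: "x \<in> E"
    then have "x \<in> half z k" by (simp add: E_def)
    then have "dists z x \<in> D" "P (dists z x) = x"
      using dists_in_region[OF half_imp] apex_unique by (auto simp: D_def c_def P_def)
    with x show "x \<in> P ` Z"
      by (intro image_eqI[of _ _ "dists z x"]) (auto simp: Z_def F_def E_def P'_def)
  next
    fix x assume "x \<in> P ` Z"
    then obtain p where "p \<in> Z" "x = P p" by blast
    then show "x \<in> E" using P[of p] by (auto simp: Z_def F_def E_def P'_def)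
  qed
  show ?thesis
  proof (cases "countable {a. uncountable {b. (a, b) \<in> Z}}")
    case True
    have "closedin (top_of_set D) Z"
      unfolding Z_def by (rule continuous_closedin_preimage_constant[OF Fcont])
    then obtain C where "closed C" "Z = D \<inter> C" by (auto simp: closedin_closed)
    then have "Z \<in> sets borel" using open_triangle_region by (simp add: D_def)
    then have "negligible Z" using True by (rule countable_uncountable_sections_imp_negligible)
    moreover have "(\<lambda>p. \<psi> (P p)) differentiable_on Z"
    proof -
      have "(\<psi> \<circ> P) differentiable (at p)" if "p \<in> Z" for p
        using that nz unfolding Z_def D_def c_def P_def
        by (intro differentiable_chain_at apex_differentiable bounded_linear_imp_differentiable bounded_linear_\<psi>) auto
      then show ?thesis by (auto simp: differentiable_on_def o_def intro: differentiable_at_withinI)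
    qed
    ultimately have "negligible ((\<lambda>p. \<psi> (P p)) ` Z)"
      by (intro negligible_differentiable_image_negligible) auto
    moreover have "(\<lambda>p. \<psi> (P p)) ` Z = \<phi> -` E"
      unfolding E by (auto simp: image_iff) (metis \<psi>_\<phi>)
    ultimately show ?thesis by simp
  next
    case False
    have "F a b = 0" if "(a, b) \<in> D" "a \<noteq> a0" for a b
    proof (rule separately_analytic_zero[where F = F and ?a0.0 = a0 and ?b0.0 = b0, OF c])
      show "real_analytic_at (F a) b" if "(a, b) \<in> triangle_region c" "a \<noteq> a0" for a b
        unfolding F_def
        using that ne[of "(a, b)"] analytic_curve_apex_snd nz z'0 z'
        by (intro real_analytic_at_diff real_analytic_at_norm analytic_curve_diff analytic_curve_const)
          (auto simp: P_def P'_def D_def c_def)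
      show "real_analytic_at (\<lambda>a. F a b) a" if "(a, b) \<in> triangle_region c" "b \<noteq> b0" for a b
        unfolding F_def
        using that ne[of "(a, b)"] analytic_curve_apex_fst nz z'0 z'
        by (intro real_analytic_at_diff real_analytic_at_norm analytic_curve_diff analytic_curve_const)
          (auto simp: P_def P'_def D_def c_def)
      show "uncountable {a. uncountable {b. (a, b) \<in> triangle_region c \<and> F a b = 0}}"
        using False by (simp add: Z_def D_def)
    qed (use that in \<open>auto simp: D_def\<close>)
    note off = this
    have "F a b = 0" if ab: "(a, b) \<in> D" for a b
    proof (cases "a = a0")
      case True
      have "isCont (\<lambda>p. F (fst p) (snd p)) (a, b)"
        using Fcont ab open_triangle_region continuous_on_eq_continuous_at unfolding D_def by blast
      then have "((\<lambda>t. F (fst (t, b)) (snd (t, b))) \<longlongrightarrow> F (fst (a, b)) (snd (a, b))) (at a)"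
        by (rule isCont_tendsto_compose) (intro tendsto_intros)
      then have lim: "((\<lambda>t. F t b) \<longlongrightarrow> F a b) (at a)" by simp
      have "\<forall>\<^sub>F t in nhds a. (t, b) \<in> D"
        unfolding D_def by (rule eventually_triangle_region(2)) (use ab in \<open>simp add: D_def\<close>)
      then have "\<forall>\<^sub>F t in at a. F t b = 0"
        unfolding eventually_at_filter by eventually_elim (use off True in blast)
      then have "((\<lambda>t. F t b) \<longlongrightarrow> 0) (at a)" by (rule tendsto_eventually)
      with lim show ?thesis by (rule tendsto_unique[OF trivial_limit_at])
    qed (use off ab in blast)
    then have "Z = D" by (auto simp: Z_def)
    moreover have "P ` D = half z k"
    proof (intro equalityI subsetI)
      fix x assume "x \<in> half z k"
      then show "x \<in> P ` D"
        using dists_in_region[OF half_imp] apex_unique by (intro image_eqI[of _ _ "dists z x"]) (auto simp: D_def c_def P_def)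
    qed (use P in auto)
    ultimately show ?thesis using E by simp
  qed
qed

text \<open>Since \<open>T\<close> preserves the distance to \<open>y\<close>, its derivative \<open>L\<close> at \<open>y\<close> preserves the norm. Differentiating the
  relations \<open>norm (T x) = norm x\<close> and \<open>norm (T x - z') = norm (x - z)\<close> at \<open>y\<close> shows that the supporting functional
  at \<open>T y\<close> attains its norm at \<open>L y\<close>, and that at \<open>T y - z'\<close> at \<open>L (y - z)\<close>. Strict convexity turns these
  into \<open>L y = T y\<close> and \<open>L (y - z) = T y - z'\<close>.\<close>

lemma equidistant_imp_linear_isometry:
  fixes z z' y :: 'a
  assumes nz: "z \<noteq> 0" "k \<noteq> 0" "k' \<noteq> 0" and z': "norm z' = norm z" and y: "y \<in> half z k"
  defines "T \<equiv> \<lambda>x. apex z' k' (dists z x)"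
  assumes T: "\<And>x. x \<in> half z k \<Longrightarrow> norm (T x - T y) = norm (x - y)"
  obtains L where "linear L" "\<And>v. norm (L v) = norm v" "L z = z'" "L y = T y"
proof -
  have z'0: "z' \<noteq> 0" using z' nz by auto
  have region: "dists z x \<in> triangle_region (norm z')" if "x \<in> half z k" for x
    using dists_in_region[OF half_imp[OF that]] z' by simp
  have Tx: "T x \<in> half z' k'" "dists z' (T x) = dists z x" if "x \<in> half z k" for x
    using apex_works[OF region[OF that] z'0 nz(3)] by (auto simp: T_def)
  have dy: "(dists z has_derivative dists_deriv z y) (at y)" by (rule dists_has_derivative[OF y])
  have "apex z' k' differentiable (at (dists z y))"
    by (rule apex_differentiable[OF region[OF y] z'0 nz(3)])
  then have "(apex z' k' \<circ> dists z) differentiable (at y)"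
    using dy by (intro differentiable_chain_at) (auto simp: differentiable_def)
  then obtain L where L: "(T has_derivative L) (at y)"
    unfolding T_def by (auto simp: differentiable_def o_def)
  have lin: "linear L" using L has_derivative_linear by blast
  have nearby: "\<forall>\<^sub>F x in nhds y. x \<in> half z k" using open_half y by (rule eventually_nhds_in_open)
  have iso: "norm (L v) = norm v" for v
  proof -
    have "((T \<circ> (\<lambda>t. y + t *\<^sub>R v)) has_derivative (L \<circ> (\<lambda>t. t *\<^sub>R v))) (at 0)"
      using L by (intro diff_chain_at) (auto intro!: derivative_eq_intros)
    then have "((\<lambda>t. T (y + t *\<^sub>R v)) has_vector_derivative L v) (at 0)"
      by (simp add: has_vector_derivative_def o_def linear_scale[OF lin])
    then have "((\<lambda>t. norm (T (y + t *\<^sub>R v) - T y - t *\<^sub>R L v) / \<bar>t\<bar>) \<longlongrightarrow> 0) (at 0)"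
      by (simp add: has_vector_derivative_def has_derivative_iff_norm)
    moreover have "\<forall>\<^sub>F t in at 0. \<bar>norm v - norm (L v)\<bar> \<le> norm (T (y + t *\<^sub>R v) - T y - t *\<^sub>R L v) / \<bar>t\<bar>"
    proof -
      have "isCont (\<lambda>t. y + t *\<^sub>R v) 0" by (intro continuous_intros)
      then have "((\<lambda>t. y + t *\<^sub>R v) \<longlongrightarrow> y) (at 0)" by (simp add: isCont_def)
      then have "\<forall>\<^sub>F t in at 0. y + t *\<^sub>R v \<in> half z k"
        using nearby by (rule eventually_compose_filterlim[rotated])
      moreover have "\<forall>\<^sub>F t in at (0::real). t \<noteq> 0" by (simp add: eventually_at_filter)
      ultimately show ?thesis
      proof eventually_elim
        case (elim t)
        have "\<bar>norm v - norm (L v)\<bar> * \<bar>t\<bar> = \<bar>norm (t *\<^sub>R v) - norm (t *\<^sub>R L v)\<bar>"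
          by (simp add: abs_mult right_diff_distrib[symmetric] mult.commute)
        also have "norm (t *\<^sub>R v) = norm (T (y + t *\<^sub>R v) - T y)"
          using T[of "y + t *\<^sub>R v"] elim by simp
        also have "\<bar>norm (T (y + t *\<^sub>R v) - T y) - norm (t *\<^sub>R L v)\<bar> \<le> norm (T (y + t *\<^sub>R v) - T y - t *\<^sub>R L v)"
          by (rule norm_triangle_ineq3)
        finally show ?case using elim by (simp add: pos_le_divide_eq)
      qed
    qed
    ultimately have "\<bar>norm v - norm (L v)\<bar> \<le> 0"
      by (rule tendsto_lowerbound) simp
    then show ?thesis by simp
  qed
  have "(dists z' \<circ> T has_derivative dists_deriv z' (T y) \<circ> L) (at y)"
    using L dists_has_derivative[OF Tx(1)[OF y]] by (intro diff_chain_at)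
  moreover have "\<forall>\<^sub>F x in at y. dists z x = (dists z' \<circ> T) x"
    using nearby Tx(2) unfolding eventually_at_filter by (auto elim: eventually_mono)
  then have "(dists z' \<circ> T has_derivative dists_deriv z y) (at y)"
    by (rule has_derivative_transform_eventually[OF dy]) (use Tx(2)[OF y] in auto)
  ultimately have "dists_deriv z' (T y) \<circ> L = dists_deriv z y" by (rule has_derivative_unique)
  then have "nd (T y) (L v) = nd y v" "nd (T y - z') (L v) = nd (y - z) v" for v
    by (auto simp: dists_deriv_def fun_eq_iff)
  note nd = this
  have n: "norm (T y) = norm y" "norm (T y - z') = norm (y - z)"
    using Tx(2)[OF y] by (auto simp: dists_def)
  have y0: "y \<noteq> 0" "y - z \<noteq> 0" "T y \<noteq> 0" "T y - z' \<noteq> 0"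
    using half_nonzero[OF y] half_nonzero[OF Tx(1)[OF y]] by auto
  have Ly: "L y = T y"
    using nd(1)[of y] n(1) iso nd_self[OF y0(1)] by (intro nd_extremal_eq y0) auto
  have "L (y - z) = T y - z'"
    using nd(2)[of "y - z"] n(2) iso nd_self[OF y0(2)] by (intro nd_extremal_eq y0) auto
  then have "L z = z'" using Ly by (simp add: linear_diff[OF lin])
  with lin iso Ly show ?thesis by (intro that)
qed

end

section \<open>Rotated reflections\<close>

context analytic_plane
begin

lemma dists_on_line_unique:
  assumes "z \<noteq> 0" "\<omega> z x = 0" "dists z y = dists z x"
  shows "y = x"
proof -
  have "\<omega> z y = 0" using assms dists_in_region_iff by metis
  then obtain l m where l: "x = l *\<^sub>R z" and m: "y = m *\<^sub>R z"
    using assms \<omega>_eq_0_imp_scaleR by metis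
  have "x - z = (l - 1) *\<^sub>R z" "y - z = (m - 1) *\<^sub>R z" by (simp_all add: l m algebra_simps)
  with assms(1,3) l m have "\<bar>m\<bar> = \<bar>l\<bar>" "\<bar>m - 1\<bar> = \<bar>l - 1\<bar>" by (auto simp: dists_def)
  then have "m = l" by linarith
  with l m show ?thesis by simp
qed

lemma half_sgn: "\<omega> z x \<noteq> 0 \<Longrightarrow> x \<in> half z (\<omega> z x)"
  by (auto simp: half_def zero_less_mult_iff)

lemma dists_plane_reflection:
  assumes z: "z \<noteq> 0"
  shows "dists z (plane_reflection z x) = dists z x"
    and "\<omega> z x \<noteq> 0 \<Longrightarrow> \<omega> z (plane_reflection z x) * \<omega> z x < 0"
proof -
  have *: "dists z (plane_reflection z x) = dists z x \<and> \<omega> z (plane_reflection z x) * \<omega> z x < 0"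
    if x: "\<omega> z x \<noteq> 0"
  proof -
    define k where "k = \<omega> z x"
    have k: "k \<noteq> 0" "- k \<noteq> 0" using x by (auto simp: k_def)
    define y where "y = apex z (- k) (dists z x)"
    have y: "y \<in> half z (- k)" "dists z y = dists z x"
      using apex_works[OF dists_in_region[OF x] z k(2)] by (auto simp: y_def)
    have "plane_reflection z x = (THE y. y \<noteq> x \<and> norm y = norm x \<and> norm (y - z) = norm (x - z))"
      using x in_span_iff_\<omega>[OF z] by (simp add: plane_reflection_def)
    also have "\<dots> = y"
    proof (rule the_equality)
      have "y \<noteq> x" using y(1) by (auto simp: half_def k_def)
      then show "y \<noteq> x \<and> norm y = norm x \<and> norm (y - z) = norm (x - z)"
        using y(2) by (simp add: dists_def)
      fix u assume u: "u \<noteq> x \<and> norm u = norm x \<and> norm (u - z) = norm (x - z)"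
      then have du: "dists z u = dists z x" by (simp add: dists_def)
      then have "\<omega> z u \<noteq> 0" using x z dists_in_region_iff by metis
      moreover have "u \<notin> half z k" using u du half_sgn[OF x] inj_on_dists by (metis k_def)
      ultimately have "u \<in> half z (- k)" using k by (auto simp: half_def not_less order_le_less)
      then show "u = y" using y du by (intro inj_on_dists) auto
    qed
    finally have "plane_reflection z x = y" .
    then show ?thesis using y by (simp add: half_def k_def mult.commute)
  qed
  show "dists z (plane_reflection z x) = dists z x"
  proof (cases "\<omega> z x = 0")
    case True
    then show ?thesis using in_span_iff_\<omega>[OF z] by (simp add: plane_reflection_def)
  qed (use * in simp)
  show "\<omega> z x \<noteq> 0 \<Longrightarrow> \<omega> z (plane_reflection z x) * \<omega> z x < 0" using * by simp
qed

lemma dists_rotation_map: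
  assumes "rotation_map z f r"
  shows "dists (f t) (r x t) = dists z x" and "norm (f t) = norm z"
proof -
  have r: "r z t = f t" "norm (r x t) = norm x" "norm (r x t - r z t) = norm (x - z)" "norm (r z t) = norm z"
    using assms unfolding rotation_map_def by blast+
  then show "dists (f t) (r x t) = dists z x" "norm (f t) = norm z" by (simp_all add: dists_def)
qed

text \<open>The determinant of \<open>f t\<close> and \<open>r x t\<close> is continuous in \<open>t\<close>, never vanishes because the triangle stays
  non-degenerate, and is \<open>\<omega> z x\<close> at \<open>t = 0\<close>.\<close>

lemma rotation_map_preserves_side:
  assumes z: "z \<noteq> 0" and r: "rotation_map z f r" and x: "\<omega> z x \<noteq> 0"
  shows "\<omega> (f t) (r x t) * \<omega> z x > 0"
proof -
  have f: "norm (f t) = norm z" "f t \<noteq> 0" for t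
    using dists_rotation_map(2)[OF r, of t] z by auto
  have ne: "\<omega> (f t) (r x t) \<noteq> 0" for t
    using dists_rotation_map(1)[OF r, where x = x and t = t] dists_in_region_iff[OF f(2), of t "r x t"] dists_in_region[OF x] f(1) by simp
  have "continuous_on UNIV (\<lambda>t. case (u, t) of (x, t) \<Rightarrow> r x t)" for u
    using r unfolding rotation_map_def
    by (intro continuous_on_compose2[of UNIV "\<lambda>(x, t). r x t" UNIV "\<lambda>t. (u, t)"] continuous_intros) auto
  then have cont: "continuous_on UNIV (r u)" for u by simp
  have "f = r z" using r by (auto simp: rotation_map_def)
  then have "continuous_on UNIV (\<lambda>t. \<omega> (f t) (r x t) * \<omega> z x)"
    using cont[of x] cont[of z] by (intro continuous_intros continuous_\<omega>) (simp_all add: eta_contract_eq)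
  then have conn: "connected (range (\<lambda>t. \<omega> (f t) (r x t) * \<omega> z x))"
    by (intro connected_continuous_image) auto
  have "f 0 = z" "r x 0 = x" using r unfolding rotation_map_def by metis+
  then have "\<omega> (f 0) (r x 0) * \<omega> z x > 0" using x by (auto simp: zero_less_mult_iff)
  moreover have "\<omega> (f t) (r x t) * \<omega> z x \<noteq> 0" using ne x by simp
  ultimately show ?thesis
    using connectedD_interval[OF conn, of "\<omega> (f t) (r x t) * \<omega> z x" "\<omega> (f 0) (r x 0) * \<omega> z x" 0] ne x
    by (force simp: not_less[symmetric])
qed

lemma open_half_plane_eq_half:
  assumes H: "open_half_plane z H" and z: "z \<noteq> 0"
  obtains k where "k \<noteq> 0" "H = half z k"
proof -
  obtain g :: "'a \<Rightarrow> real" where g: "linear g" "{x. g x = 0} = span {z}" "H = {x. g x > 0}"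
    using H unfolding open_half_plane_def by blast
  obtain w where w: "\<omega> z w > 0" using exists_\<omega>_pos[OF z, of 1] by auto
  have gz: "g z = 0" using g(2) span_base[of z "{z}"] by blast
  define k where "k = g w / \<omega> z w"
  have "g x = k * \<omega> z x" for x
  proof -
    have "g (\<omega> z w *\<^sub>R x) = g (\<omega> x w *\<^sub>R z + \<omega> z x *\<^sub>R w)" by (simp add: \<omega>_cramer[of z w x])
    then have "\<omega> z w * g x = \<omega> z x * g w"
      using gz by (simp add: linear_add[OF g(1)] linear_scale[OF g(1)])
    then show ?thesis using w by (simp add: k_def field_simps)
  qed
  moreover have "k \<noteq> 0"
  proof
    assume "k = 0"
    then have "g w = 0" using w by (simp add: k_def)
    then have "w \<in> {x. g x = 0}" by simp
    then have "\<omega> z w = 0" unfolding g(2) in_span_iff_\<omega>[OF z] .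
    with w show False by simp
  qed
  ultimately show ?thesis using that g(3) by (simp add: half_def)
qed

text \<open>A point is determined by its distances to \<open>0\<close> and \<open>z'\<close> and its side of the base. The linear map \<open>L\<close> matches \<open>S\<close> in
  both respects: the sides agree at \<open>y\<close>, hence everywhere, because a linear map with \<open>L z = z'\<close> changes the
  determinant with the base by a constant factor.\<close>

lemma rotated_reflection_isometry:
  fixes z z' y :: 'a and S :: "'a \<Rightarrow> 'a"
  assumes z: "z \<noteq> 0" and z': "norm z' = norm z"
    and S: "\<And>x. dists z' (S x) = dists z x"
    and side: "\<And>x. \<omega> z x \<noteq> 0 \<Longrightarrow> \<omega> z' (S x) * \<omega> z x < 0"
    and L: "linear L" "\<And>v. norm (L v) = norm v" "L z = z'" "L y = S y"
    and y: "\<omega> z y \<noteq> 0"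
  shows "isometry S"
proof -
  have z'0: "z' \<noteq> 0" using z z' by auto
  \<comment> \<open>A linear isometry with \<open>L z = z'\<close> preserves both side lengths, as \<open>S\<close> does.\<close>
  have LS: "dists z' (L x) = dists z' (S x)" for x
    using S[of x] L(2)[of x] L(2)[of "x - z"] by (simp add: dists_def linear_diff[OF L(1)] L(3))
  \<comment> \<open>Cramer's rule expresses \<open>x\<close> in terms of \<open>z\<close> and \<open>y\<close>, whose images under \<open>L\<close> are known.\<close>
  have scaled: "\<omega> z y * \<omega> z' (L x) = \<omega> z x * \<omega> z' (S y)" for x
  proof -
    have "L (\<omega> z y *\<^sub>R x) = L (\<omega> x y *\<^sub>R z + \<omega> z x *\<^sub>R y)" by (simp add: \<omega>_cramer[of z y x])
    then have "\<omega> z y *\<^sub>R L x = \<omega> x y *\<^sub>R z' + \<omega> z x *\<^sub>R S y"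
      by (simp add: linear_add[OF L(1)] linear_scale[OF L(1)] L(3,4))
    then have "\<omega> z' (\<omega> z y *\<^sub>R L x) = \<omega> z' (\<omega> x y *\<^sub>R z' + \<omega> z x *\<^sub>R S y)" by simp
    then show ?thesis by simp
  qed
  have "L x = S x" for x
  proof (cases "\<omega> z x = 0")
    case True
    then have "\<omega> z' (S x) = 0"
      using dists_in_region_iff[OF z'0, of "S x"] dists_in_region_iff[OF z, of x] S[of x] z' by simp
    then show ?thesis using LS z'0 by (intro dists_on_line_unique) auto
  next
    case False
    have Sx: "S x \<in> half z' (- \<omega> z x)" using side[OF False] by (simp add: half_def mult.commute)
    have "(\<omega> z y)\<^sup>2 * (\<omega> z' (L x) * \<omega> z x) = (\<omega> z' (S y) * \<omega> z y) * (\<omega> z x)\<^sup>2"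
      using scaled[of x] by (simp add: power2_eq_square)
    also have "\<dots> < 0" using side[OF y] False by (simp add: mult_less_0_iff)
    finally have "\<omega> z' (L x) * \<omega> z x < 0" by (simp add: mult_less_0_iff)
    then have "L x \<in> half z' (- \<omega> z x)" by (simp add: half_def mult.commute)
    then show ?thesis using Sx LS by (intro inj_on_dists) auto
  qed
  then have "S = L" by auto
  then show ?thesis
    using L(2) by (simp add: isometry_def dist_norm linear_diff[OF L(1), symmetric])
qed

text \<open>The exceptional set in the half-plane is null or everything; in the latter case the rotated
  reflection would be a linear isometry.\<close>

lemma rotated_reflection_separates:
  assumes z: "z \<noteq> 0" and r: "rotation_map z f r" and k: "k \<noteq> 0" and y: "y \<in> half z k"
    and not_iso: "\<not> isometry (\<lambda>x. r (plane_reflection z x) t)"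
  defines "S \<equiv> \<lambda>x. r (plane_reflection z x) t"
  defines "U \<equiv> {x \<in> half z k. norm (S x - S y) \<noteq> norm (x - y)}"
  shows "open U" "conull_subset U (half z k)"
proof -
  define z' where "z' = f t"
  have z': "norm z' = norm z" using dists_rotation_map(2)[OF r] by (simp add: z'_def)
  have z'0: "z' \<noteq> 0" using z z' by auto
  have S: "dists z' (S x) = dists z x" for x
    unfolding S_def z'_def by (simp add: dists_rotation_map(1)[OF r] dists_plane_reflection(1)[OF z])
  have side: "\<omega> z' (S x) * \<omega> z x < 0" if "\<omega> z x \<noteq> 0" for x
  proof -
    have R: "\<omega> z (plane_reflection z x) * \<omega> z x < 0" using that by (rule dists_plane_reflection(2)[OF z])
    then have "\<omega> z' (S x) * \<omega> z (plane_reflection z x) > 0"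
      unfolding S_def z'_def by (intro rotation_map_preserves_side[OF z r]) auto
    with R show ?thesis by (auto simp: mult_less_0_iff zero_less_mult_iff)
  qed
  have S_half: "S x \<in> half z' (- k)" if "x \<in> half z k" for x
    using side[OF half_imp[OF that]] that by (auto simp: half_def mult_less_0_iff zero_less_mult_iff)
  then have S_apex: "apex z' (- k) (dists z x) = S x" if "x \<in> half z k" for x
    using that S by (intro apex_unique) auto
  have "continuous_on (half z k) (\<lambda>x. apex z' (- k) (dists z x))"
    using continuous_on_apex[OF z'0, of "- k"] k z' dists_in_region[OF half_imp]
    by (intro continuous_on_compose2[OF _ continuous_dists]) auto
  then have "continuous_on (half z k) S"
    by (rule continuous_on_cong[THEN iffD1, rotated 2]) (simp_all add: S_apex)
  then have "continuous_on (half z k) (\<lambda>x. norm (S x - S y) - norm (x - y))"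
    by (intro continuous_intros)
  then have "open (half z k \<inter> (\<lambda>x. norm (S x - S y) - norm (x - y)) -` (- {0}))"
    by (rule continuous_open_preimage[OF _ open_half]) auto
  also have "half z k \<inter> (\<lambda>x. norm (S x - S y) - norm (x - y)) -` (- {0}) = U"
    by (auto simp: U_def)
  finally show "open U" .
  have E: "{x \<in> half z k. norm (apex z' (- k) (dists z x) - S y) = norm (x - y)} = half z k - U"
    by (auto simp: U_def S_apex)
  have "half z k - U \<noteq> half z k"
  proof
    assume "half z k - U = half z k"
    then have "norm (S x - S y) = norm (x - y)" if "x \<in> half z k" for x
      using that by (auto simp: U_def)
    then obtain L where "linear L" "\<And>v. norm (L v) = norm v" "L z = z'" "L y = S y"
      using equidistant_imp_linear_isometry[OF z k _ z' y, of "- k"] k S_apex y by auto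
    then have "isometry S"
      using rotated_reflection_isometry[OF z z' S side] half_imp[OF y] by blast
    with not_iso show False by (simp add: S_def)
  qed
  then have "negligible (\<phi> -` (half z k - U))"
    using equidistance_null_or_everywhere[OF z k _ z' y S_half[OF y] S] k unfolding E by auto
  then have "lebesgue_null (half z k - U)"
    unfolding lebesgue_null_def using coordinates by (auto simp: negligible_iff_null_sets)
  then show "conull_subset U (half z k)" by (auto simp: conull_subset_def U_def)
qed

end

theorem theorem4p14:
  fixes z :: "'a::real_normed_vector"
    and H :: "'a set"
    and f :: "real \<Rightarrow> 'a"
    and r :: "'a \<Rightarrow> real \<Rightarrow> 'a"
  assumes "normed_plane TYPE('a)"
    and "analytic_norm TYPE('a)"
    and "\<not> euclidean_norm TYPE('a)"
    and "normal_point z"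
    and "open_half_plane z H"
    and "circle_param z f"
    and "rotation_map z f r"
  shows "\<exists>Y. comeagre_subset Y H \<and>
    (\<forall>y\<in>Y. \<forall>t. \<not> isometry (\<lambda>x. r (plane_reflection z x) t) \<longrightarrow>
      (\<exists>U. open U \<and> conull_subset U H \<and>
        (\<forall>x\<in>U. norm (r (plane_reflection z x) t - r (plane_reflection z y) t) \<noteq> norm (x - y))))"
proof -
  obtain \<phi> :: "real ^ 2 \<Rightarrow> 'a" where "linear_coordinates \<phi>" "(\<lambda>u. norm (\<phi> u)) real_analytic_on (- {0})"
    using assms(2) unfolding analytic_norm_def by blast
  then interpret analytic_plane \<phi> by unfold_locales
  have z: "z \<noteq> 0" using assms(4) by (simp add: normal_point_def)
  obtain k where k: "k \<noteq> 0" and H: "H = half z k"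
    using open_half_plane_eq_half[OF assms(5) z] .
  have "comeagre_subset H H"
    unfolding comeagre_subset_def by (intro conjI exI[of _ "{}"]) auto
  moreover have "\<exists>U. open U \<and> conull_subset U H \<and>
      (\<forall>x\<in>U. norm (r (plane_reflection z x) t - r (plane_reflection z y) t) \<noteq> norm (x - y))"
    if "y \<in> H" "\<not> isometry (\<lambda>x. r (plane_reflection z x) t)" for y t
    using rotated_reflection_separates[OF z assms(7) k that(1)[unfolded H] that(2)] unfolding H by blast
  ultimately show ?thesis by blast
qed

end
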